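(* Let $\mathbb K\in\{\mathbb R,\mathbb C\}$ and $1\le p<\infty$. Then, as $d\to\infty$, $$\mathbf c(\ell_p^d(\mathbb K))\asymp \sqrt d \ \text{ if } p\ge 2,\qquad \mathbf c(\ell_p^d(\mathbb K))\asymp \sqrt[p]{d}\ \text{ if } p\le 2.$$ For $p=\infty$: $\sqrt d\prec \mathbf c(\ell_\infty^d(\mathbb K))\prec\sqrt{d\log d}$.
   Context: For a Banach space $X$ over $\mathbb K$ and $n\in\mathbb N$, $\mathbf c_n(X)$ is the smallest constant such that for all $\psi_1,\dots,\psi_n\in X^*$, $\|\psi_1\|\cdots\|\psi_n\|\le \mathbf c_n(X)\,\|\psi_1\cdots\psi_n\|$, where $\psi_1\cdots\psi_n$ is the pointwise product and $\|P\|=\sup_{\|x\|=1}|P(x)|$; $\mathbf c(X)=\lim_{n\to\infty}\mathbf c_n(X)^{1/n}$ (this limit exists). $\ell_p^d(\mathbb K)$ is $\mathbb K^d$ with the $p$-norm. For positive sequences, $a_d\prec b_d$ means there is a constant $L>0$ (independent of $d$, possibly depending on $p$ and $\mathbb K$) with $a_d\le L b_d$ for all $d$; $a_d\asymp b_d$ means $a_d\prec b_d$ and $b_d\prec a_d$. *)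

theory Defs
  imports "HOL-Analysis.Analysis"
begin

definition vecs :: "nat \<Rightarrow> (nat \<Rightarrow> 'k::real_normed_field) set" where
  "vecs d = {x. \<forall>i\<ge>d. x i = 0}"

text \<open>The dual space: (continuous = all, finite dimension) \<open>\<K>\<close>-linear functionals on \<open>vecs d\<close>.\<close>
definition dualsp :: "nat \<Rightarrow> ((nat \<Rightarrow> 'k::real_normed_field) \<Rightarrow> 'k) set" where
  "dualsp d = {\<psi>. (\<forall>x\<in>vecs d. \<forall>y\<in>vecs d. \<psi> (\<lambda>i. x i + y i) = \<psi> x + \<psi> y) \<and>
                   (\<forall>c. \<forall>x\<in>vecs d. \<psi> (\<lambda>i. c * x i) = c * \<psi> x)}"

definition fnorm :: "((nat \<Rightarrow> 'k::real_normed_field) \<Rightarrow> real) \<Rightarrow> nat \<Rightarrow> ((nat \<Rightarrow> 'k) \<Rightarrow> 'k) \<Rightarrow> real" where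
  "fnorm N d f = (SUP x\<in>{x\<in>vecs d. N x = 1}. norm (f x))"

definition cn :: "((nat \<Rightarrow> 'k::real_normed_field) \<Rightarrow> real) \<Rightarrow> nat \<Rightarrow> nat \<Rightarrow> real" where
  "cn N d n = Inf {C. 0 \<le> C \<and> (\<forall>\<psi>::nat \<Rightarrow> (nat \<Rightarrow> 'k) \<Rightarrow> 'k. (\<forall>i<n. \<psi> i \<in> dualsp d) \<longrightarrow>
        (\<Prod>i<n. fnorm N d (\<psi> i)) \<le> C * fnorm N d (\<lambda>x. \<Prod>i<n. \<psi> i x))}"

definition cconst :: "((nat \<Rightarrow> 'k::real_normed_field) \<Rightarrow> real) \<Rightarrow> nat \<Rightarrow> real" where
  "cconst N d = lim (\<lambda>n. cn N d n powr (1 / real n))"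

definition lpnorm :: "real \<Rightarrow> nat \<Rightarrow> (nat \<Rightarrow> 'k::real_normed_field) \<Rightarrow> real" where
  "lpnorm p d x = (\<Sum>i<d. norm (x i) powr p) powr (1 / p)"

definition linfnorm :: "nat \<Rightarrow> (nat \<Rightarrow> 'k::real_normed_field) \<Rightarrow> real" where
  "linfnorm d x = Max ((\<lambda>i. norm (x i)) ` {..<d})"

definition c_lp :: "'k::real_normed_field itself \<Rightarrow> real \<Rightarrow> nat \<Rightarrow> real" where
  "c_lp _ p d = cconst (lpnorm p d :: (nat \<Rightarrow> 'k) \<Rightarrow> real) d"

definition c_linf :: "'k::real_normed_field itself \<Rightarrow> nat \<Rightarrow> real" where
  "c_linf _ d = cconst (linfnorm d :: (nat \<Rightarrow> 'k) \<Rightarrow> real) d"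

definition prec_from :: "nat \<Rightarrow> (nat \<Rightarrow> real) \<Rightarrow> (nat \<Rightarrow> real) \<Rightarrow> bool" where
  "prec_from d0 a b = (\<exists>L>0. \<forall>d\<ge>d0. a d \<le> L * b d)"

definition asymp_from :: "nat \<Rightarrow> (nat \<Rightarrow> real) \<Rightarrow> (nat \<Rightarrow> real) \<Rightarrow> bool" where
  "asymp_from d0 a b = (prec_from d0 a b \<and> prec_from d0 b a)"

end

theory Submission
  imports Defs "HOL-Probability.Probability"
begin

text \<open>
  Concatenating families of functionals gives \<open>c\<^sub>m c\<^sub>n \<le> c\<^bsub>m+n\<^esub>\<close>, so by Fekete's lemma \<open>c\<close> is the supremum
  of the numbers \<open>c\<^sub>n\<^bsup>1/n\<^esup>\<close>, and \<open>c\<close> is bounded by \<open>M\<close> as soon as \<open>c\<^sub>n \<le> M\<^sup>n\<close> for all \<open>n\<close>.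

  Upper bounds: let \<open>g\<close> be a standard Gaussian vector in \<open>\<real>\<^sup>d\<close>. For unit vectors \<open>a\<^sub>1, \<dots>, a\<^sub>n\<close> each \<open>\<langle>a\<^sub>j, g\<rangle>\<close> is
  standard normal, so the mean over \<open>j\<close> of \<open>\<bar>\<langle>a\<^sub>j, g\<rangle>\<bar>\<^bsup>-1/2\<^esup>\<close> has bounded expectation. Some point \<open>x\<close> therefore keeps this
  mean bounded, whence \<open>\<Prod>\<bar>\<langle>a\<^sub>j, x\<rangle>\<bar> \<ge> c\<^sup>n\<close> by AM-GM, and at the same time has a typical even moment
  \<open>\<Sum>x\<^sub>i\<^bsup>2k\<^esup>\<close>. The norm of \<open>x\<close> is then of order \<open>d\<^bsup>1/p\<^esup>\<close> (fixed \<open>k \<ge> p/2\<close>), or \<open>(log d)\<^bsup>1/2\<^esup>\<close> for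
  \<open>p = \<infinity>\<close> (\<open>k\<close> of order \<open>log d\<close>), while functional norms are compared with \<open>\<ell>\<^sub>2\<close> norms through the
  largest \<open>\<ell>\<^sub>2\<close> norm on the unit sphere.

  Lower bounds: by AM-GM the product of the \<open>d\<close> coordinates is small when \<open>p \<le> 2\<close>, and the product of all
  \<open>2\<^sup>d\<close> functionals with coefficients \<open>\<plusminus>1\<close> is small when \<open>p \<ge> 2\<close>.
\<close>

subsection \<open>Elementary inequalities and Fekete's lemma\<close>

text \<open>AM-GM with a prescribed bound \<open>A\<close> on the mean:
  \<open>t \<le> exp (t - 1)\<close> at \<open>t = f i / A\<close> is multiplied over
  \<open>I\<close>, and the exponents add up to at most 0.\<close>

lemma prod_le_power_of_sum_le:
  fixes f :: "'a \<Rightarrow> real"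
  assumes "finite I" "\<And>i. i \<in> I \<Longrightarrow> 0 \<le> f i" "0 < A" "(\<Sum>i\<in>I. f i) \<le> real (card I) * A"
  shows "(\<Prod>i\<in>I. f i) \<le> A ^ card I"
proof -
  have "(\<Prod>i\<in>I. f i) \<le> (\<Prod>i\<in>I. A * exp (f i / A - 1))"
  proof (intro prod_mono conjI assms)
    fix i
    have "f i / A \<le> exp (f i / A - 1)" using exp_ge_add_one_self[of "f i / A - 1"] by simp
    then show "f i \<le> A * exp (f i / A - 1)" using \<open>0 < A\<close> by (simp add: field_simps)
  qed
  also have "\<dots> = A ^ card I * exp ((\<Sum>i\<in>I. f i) / A - card I)"
    using \<open>finite I\<close> by (simp add: prod.distrib exp_sum[symmetric] sum_subtractf sum_divide_distrib)
  also have "(\<Sum>i\<in>I. f i) / A - card I \<le> 0" using assms by (simp add: field_simps)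
  finally show ?thesis using \<open>0 < A\<close> by (simp add: mult_left_le)
qed

text \<open>AM-GM for the numbers \<open>f i powr r\<close>. The lower bounds use
  \<open>r = 2\<close> for sign functionals and \<open>r = p\<close> for coordinates.\<close>

lemma prod_le_power_of_sum_powr_le:
  fixes f :: "'a \<Rightarrow> real"
  assumes "finite I" "\<And>i. i \<in> I \<Longrightarrow> 0 \<le> f i" "0 < A" "0 < r"
    "(\<Sum>i\<in>I. f i powr r) \<le> real (card I) * A powr r"
  shows "(\<Prod>i\<in>I. f i) \<le> A ^ card I"
proof -
  have "(\<Prod>i\<in>I. f i powr r) \<le> (A powr r) ^ card I"
    using assms by (intro prod_le_power_of_sum_le) auto
  also have "(\<Prod>i\<in>I. f i powr r) = (\<Prod>i\<in>I. f i) powr r"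
    using assms by (simp add: prod_powr_distrib)
  also have "(A powr r) ^ card I = (A ^ card I) powr r"
    using \<open>0 < A\<close> by (simp add: powr_powr powr_realpow[symmetric] mult.commute)
  finally show ?thesis
    using \<open>0 < A\<close> \<open>0 < r\<close> powr_less_mono2[of r "A ^ card I" "\<Prod>i\<in>I. f i"]
    by (meson linorder_not_le zero_le_power less_imp_le)
qed

text \<open>Second moment of a Rademacher sum, \<open>A\<close> being the set of plus signs. Subsets
  with and without the new element pair off, and the parallelogram law evaluates each pair.\<close>

lemma sum_norm_signed_sum_squared:
  fixes x :: "'a \<Rightarrow> 'b::real_inner"
  assumes "finite D"
  shows "(\<Sum>A\<in>Pow D. (norm (\<Sum>i\<in>D. if i \<in> A then x i else - x i))\<^sup>2) = 2 ^ card D * (\<Sum>i\<in>D. (norm (x i))\<^sup>2)"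
  using assms
proof (induction D rule: finite_induct)
  case empty
  then show ?case by simp
next
  case (insert a D)
  define u where "u A = (\<Sum>i\<in>D. if i \<in> A then x i else - x i)" for A
  have u_insert: "u (insert a A) = u A" if "A \<in> Pow D" for A
    unfolding u_def using insert.hyps by (intro sum.cong) auto
  have disj: "Pow D \<inter> insert a ` Pow D = {}" using insert.hyps by auto
  have inj: "inj_on (insert a) (Pow D)" using insert.hyps by (auto intro!: inj_onI)
  have "(\<Sum>A\<in>Pow (insert a D). (norm (\<Sum>i\<in>insert a D. if i \<in> A then x i else - x i))\<^sup>2)
      = (\<Sum>A\<in>Pow D. (norm (- x a + u A))\<^sup>2) + (\<Sum>A\<in>Pow D. (norm (x a + u A))\<^sup>2)"
    unfolding Pow_insert using insert.hyps disj inj u_insert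
    by (subst sum.union_disjoint)
      (auto simp: sum.reindex u_def intro!: arg_cong2[where f = "(+)"] sum.cong)
  also have "\<dots> = (\<Sum>A\<in>Pow D. 2 * (norm (x a))\<^sup>2 + 2 * (norm (u A))\<^sup>2)"
    unfolding sum.distrib[symmetric]
    by (intro sum.cong refl) (simp add: power2_norm_eq_inner algebra_simps inner_commute)
  also have "\<dots> = 2 ^ card (insert a D) * (\<Sum>i\<in>insert a D. (norm (x i))\<^sup>2)"
    using insert by (simp add: sum.distrib sum_distrib_left[symmetric] u_def card_Pow algebra_simps)
  finally show ?case .
qed

lemma cauchy_schwarz_sum_mult:
  fixes b x :: "'i \<Rightarrow> 'k::real_normed_field"
  shows "norm (\<Sum>i\<in>I. x i * b i) \<le> sqrt (\<Sum>i\<in>I. (norm (b i))\<^sup>2) * sqrt (\<Sum>i\<in>I. (norm (x i))\<^sup>2)"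
proof -
  have "norm (\<Sum>i\<in>I. x i * b i) \<le> (\<Sum>i\<in>I. \<bar>norm (b i)\<bar> * \<bar>norm (x i)\<bar>)"
    using norm_sum[of "\<lambda>i. x i * b i" I] by (simp add: norm_mult mult.commute)
  also have "\<dots> \<le> sqrt (\<Sum>i\<in>I. (norm (b i))\<^sup>2) * sqrt (\<Sum>i\<in>I. (norm (x i))\<^sup>2)"
    using L2_set_mult_ineq[of "\<lambda>i. norm (b i)" "\<lambda>i. norm (x i)" I] by (simp add: L2_set_def)
  finally show ?thesis .
qed

text \<open>Fekete's lemma. Naming the limit as a supremum makes each quotient with
  \<open>0 < n\<close> a lower bound for it.\<close>

lemma superadditive_quotient_tendsto:
  fixes b :: "nat \<Rightarrow> real"
  assumes super: "\<And>m n. b m + b n \<le> b (m + n)" and nonneg: "\<And>n. 0 \<le> b n"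
    and bound: "\<And>n. b n \<le> real n * B"
  shows "(\<lambda>n. b n / real n) \<longlonglongrightarrow> (SUP n\<in>{0<..}. b n / real n)"
proof -
  have bdd: "bdd_above ((\<lambda>n. b n / real n) ` {0<..})"
    using bound by (intro bdd_aboveI2[of _ _ B]) (auto simp: field_simps)
  have mult: "real q * b m \<le> b (q * m)" for q m
  proof (induction q)
    case 0
    then show ?case using nonneg by simp
  next
    case (Suc q)
    then show ?case using super[of m "q * m"] by (simp add: algebra_simps)
  qed
  show ?thesis
  proof (rule order_tendstoI)
    fix y assume "y < (SUP n\<in>{0<..}. b n / real n)"
    then obtain m where m: "0 < m" "y < b m / real m"
      using bdd by (subst (asm) less_cSUP_iff) auto
    \<comment> \<open>Split \<open>n\<close> into \<open>n div m\<close> full blocks of length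
      \<open>m\<close> and a remainder of nonnegative value; less than one block is lost, at cost at
      most \<open>b m / n\<close>.\<close>
    have lower: "b m / real m - b m / real n \<le> b n / real n" if "0 < n" for n
    proof -
      have "real n / real m - 1 \<le> real (n div m)"
        using of_nat_mono[OF less_imp_le, of n "n div m * m + m", where 'a = real] dividend_less_div_times[OF m(1), of n] m(1)
        by (simp add: field_simps)
      then have "(real n / real m - 1) * b m \<le> real (n div m) * b m"
        using nonneg by (intro mult_right_mono)
      also have "\<dots> \<le> b (n div m * m)" by (rule mult)
      also have "\<dots> \<le> b (n div m * m) + b (n mod m)" using nonneg by simp
      also have "\<dots> \<le> b n" using super[of "n div m * m" "n mod m"] by simp
      finally have "(real n / real m - 1) * b m / real n \<le> b n / real n"
        by (intro divide_right_mono) auto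
      moreover have "(real n / real m - 1) * b m / real n = b m / real m - b m / real n"
        using that by (simp add: field_simps)
      ultimately show ?thesis by simp
    qed
    have "(\<lambda>n. b m / real m - b m / real n) \<longlonglongrightarrow> b m / real m - 0"
      by (intro tendsto_intros lim_const_over_n)
    then have "\<forall>\<^sub>F n in sequentially. y < b m / real m - b m / real n"
      using m by (intro order_tendstoD(1)) auto
    then show "\<forall>\<^sub>F n in sequentially. y < b n / real n"
      using eventually_gt_at_top[of 0]
    proof eventually_elim
      case (elim n)
      then show ?case using lower[of n] by linarith
    qed
  next
    fix y assume y: "(SUP n\<in>{0<..}. b n / real n) < y"
    show "\<forall>\<^sub>F n in sequentially. b n / real n < y"
      using eventually_gt_at_top[of 0]
    proof eventually_elim
      case (elim n)
      then have "b n / real n \<le> (SUP n\<in>{0<..}. b n / real n)"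
        using bdd by (intro cSUP_upper) auto
      with y show ?case by linarith
    qed
  qed
qed

subsection \<open>Gaussian vectors\<close>

text \<open>The case distinction is needed because \<open>0 powr a = 0\<close>.\<close>

definition inv_sqrt_abs :: "real \<Rightarrow> ennreal" where
  "inv_sqrt_abs t = (if t = 0 then \<infinity> else ennreal (\<bar>t\<bar> powr (-1/2)))"

lemma measurable_inv_sqrt_abs [measurable]: "inv_sqrt_abs \<in> borel_measurable borel"
  unfolding inv_sqrt_abs_def by measurable

lemma nn_integral_powr_neg_half: "(\<integral>\<^sup>+t. ennreal (t powr (-1/2) * indicator {0..1} t) \<partial>lborel) = 2"
proof -
  have "((\<lambda>t::real. t powr (-1/2)) has_integral 2) {0..1}"
    using has_integral_powr_from_0[of "-1/2" 1] by simp
  then have "((\<lambda>t. t powr (-1/2) * indicator {0..1} t) has_integral 2) (UNIV::real set)"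
    by (subst (asm) has_integral_restrict_UNIV[symmetric]) (auto elim!: has_integral_eq_rhs simp: indicator_def of_bool_def if_distrib cong: if_cong)
  then show ?thesis
    by (subst nn_integral_has_integral_lborel) auto
qed

lemma std_normal_density_le_1: "std_normal_density t \<le> 1"
proof -
  have "1 \<le> sqrt (2 * pi)" using pi_gt3 by simp
  moreover have "exp (- t\<^sup>2 / 2) \<le> 1" by simp
  ultimately show ?thesis
    unfolding std_normal_density_def by (intro mult_le_one) (auto simp: field_simps)
qed

text \<open>\<open>5 = 1 + 2 + 2\<close>: for \<open>\<bar>t\<bar> > 1\<close> the singular factor
  is at most 1 and the total mass 1 dominates; on each half of \<open>[-1, 1]\<close> the density is
  at most 1 and the singular factor has integral 2. The two conventions at 0 differ on a null set
  only.\<close>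

lemma nn_integral_normal_inv_sqrt_abs:
  "(\<integral>\<^sup>+t. ennreal (std_normal_density t) * inv_sqrt_abs t \<partial>lborel) \<le> 5"
proof -
  let ?h = "\<lambda>t::real. t powr (-1/2) * indicator {0..1} t"
  have "(\<integral>\<^sup>+t. ennreal (std_normal_density t) * inv_sqrt_abs t \<partial>lborel)
     = (\<integral>\<^sup>+t. ennreal (std_normal_density t) * ennreal (\<bar>t\<bar> powr (-1/2)) \<partial>lborel)"
    by (intro nn_integral_cong_AE) (use AE_lborel_singleton[of "0::real"] in \<open>eventually_elim, simp add: inv_sqrt_abs_def\<close>)
  also have "\<dots> \<le> (\<integral>\<^sup>+t. ennreal (std_normal_density t) + (ennreal (?h t) + ennreal (?h (- t))) \<partial>lborel)"
  proof (intro nn_integral_mono)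
    fix t :: real
    have "std_normal_density t * \<bar>t\<bar> powr (-1/2) \<le> std_normal_density t + (?h t + ?h (- t))"
    proof (cases "\<bar>t\<bar> \<le> 1")
      case True
      have "std_normal_density t * \<bar>t\<bar> powr (-1/2) \<le> 1 * \<bar>t\<bar> powr (-1/2)"
        by (intro mult_right_mono std_normal_density_le_1) auto
      also have "\<dots> \<le> ?h t + ?h (- t)" using True by (auto simp: indicator_def)
      finally show ?thesis using normal_density_nonneg[of 0 1 t] by linarith
    next
      case False
      have "\<bar>t\<bar> powr (-1/2) \<le> 1" using False powr_mono[of "-1/2" 0 "\<bar>t\<bar>"] by (auto split: if_splits)
      then have "std_normal_density t * \<bar>t\<bar> powr (-1/2) \<le> std_normal_density t * 1"
        by (intro mult_left_mono) auto
      moreover have "0 \<le> ?h t + ?h (- t)" by simp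
      ultimately show ?thesis by linarith
    qed
    then show "ennreal (std_normal_density t) * ennreal (\<bar>t\<bar> powr (-1/2))
      \<le> ennreal (std_normal_density t) + (ennreal (?h t) + ennreal (?h (- t)))"
      by (simp add: ennreal_mult[symmetric] ennreal_plus[symmetric] del: ennreal_plus)
  qed
  also have "\<dots> = (\<integral>\<^sup>+t. ennreal (std_normal_density t) \<partial>lborel) +
      ((\<integral>\<^sup>+t. ennreal (?h t) \<partial>lborel) + (\<integral>\<^sup>+t. ennreal (?h (- t)) \<partial>lborel))"
    by (simp add: nn_integral_add)
  also have "(\<integral>\<^sup>+t. ennreal (?h (- t)) \<partial>lborel) = 2"
    using nn_integral_real_affine[of "\<lambda>t. ennreal (?h t)" "-1" 0] nn_integral_powr_neg_half by simp
  also have "(\<integral>\<^sup>+t. ennreal (std_normal_density t) \<partial>lborel) = 1"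
    using prob_space.emeasure_space_1[OF prob_space_normal_density[of 1 0]] by (simp add: emeasure_density)
  finally show ?thesis unfolding nn_integral_powr_neg_half by simp
qed

text \<open>The exact moment is \<open>fact (2 * k) / (2 ^ k * fact k)\<close>, and
  \<open>fact (2 * k) / fact k\<close> is a product of \<open>k\<close> factors, each at most
  \<open>2 * k\<close>.\<close>

lemma nn_integral_normal_even_moment:
  "(\<integral>\<^sup>+t. ennreal (std_normal_density t) * ennreal (t ^ (2 * k)) \<partial>lborel) \<le> ennreal (real ((2 * k) ^ k))"
proof -
  have "(\<integral>\<^sup>+t. ennreal (std_normal_density t) * ennreal (t ^ (2 * k)) \<partial>lborel)
      = (\<integral>\<^sup>+t. ennreal (std_normal_density t * t ^ (2 * k)) \<partial>lborel)"
    by (simp add: ennreal_mult)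
  also have "\<dots> = ennreal (fact (2 * k) / (2 ^ k * fact k))"
    using std_normal_moment_even[of k]
    by (subst nn_integral_eq_integral) (auto simp: has_bochner_integral_iff)
  also have "\<dots> \<le> ennreal (real ((2 * k) ^ k))"
  proof (intro ennreal_leI)
    have "fact (2 * k) = fact k * (\<Prod>i\<in>{k+1..2*k}. i)"
    proof -
      have "{1..2 * k} = {1..k} \<union> {k + 1..2 * k}" by auto
      then show ?thesis by (simp add: fact_prod prod.union_disjoint del: One_nat_def)
    qed
    also have "(\<Prod>i\<in>{k+1..2*k}. i) \<le> (2 * k) ^ k"
      using prod_mono[of "{k+1..2*k}" "\<lambda>i. i" "\<lambda>_. 2 * k"] by simp
    finally have "(fact (2 * k) :: nat) \<le> fact k * (2 * k) ^ k" by simp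
    then have "real (fact (2 * k)) \<le> real (fact k * (2 * k) ^ k)" by (rule of_nat_mono)
    then have "fact (2 * k) / fact k \<le> real ((2 * k) ^ k)"
      by (simp add: field_simps)
    moreover have "fact (2 * k) / (2 ^ k * fact k) \<le> fact (2 * k) / (fact k :: real)"
      by (intro divide_left_mono) auto
    ultimately show "fact (2 * k) / (2 ^ k * fact k) \<le> real ((2 * k) ^ k)" by linarith
  qed
  finally show ?thesis .
qed

section \<open>Standard Gaussian vectors and their linear images\<close>

definition gauss :: "nat \<Rightarrow> (nat \<Rightarrow> real) measure" where
  "gauss d = (\<Pi>\<^sub>M i\<in>{..<d}. density lborel std_normal_density)"

lemma prob_space_gauss: "prob_space (gauss d)"
  unfolding gauss_def by (intro prob_space_PiM prob_space_normal_density) simp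

lemma distributed_gauss_component:
  assumes "i < d"
  shows "distributed (gauss d) lborel (\<lambda>x. x i) std_normal_density"
proof -
  have "distr (gauss d) (density lborel std_normal_density) (\<lambda>x. x i) = density lborel std_normal_density"
    unfolding gauss_def using assms prob_space_normal_density[of 1 0]
    by (intro distr_PiM_component) auto
  moreover have "distr (gauss d) (density lborel std_normal_density) (\<lambda>x. x i) = distr (gauss d) lborel (\<lambda>x. x i)"
    by (intro distr_cong) auto
  moreover have "(\<lambda>x. x i) \<in> measurable (gauss d) (density lborel std_normal_density)"
    unfolding gauss_def using assms by (intro measurable_component_singleton) simp
  ultimately show ?thesis
    unfolding distributed_def by simp
qed

lemma indep_gauss_components:
  assumes "I \<subseteq> {..<d}" "I \<noteq> {}"
  shows "prob_space.indep_vars (gauss d) (\<lambda>i. borel) (\<lambda>i x. x i) I"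
proof -
  interpret prob_space "gauss d" by (rule prob_space_gauss)
  let ?N = "density lborel std_normal_density"
  have meas: "(\<lambda>x. x i) \<in> measurable (gauss d) ?N" if "i < d" for i
    unfolding gauss_def using that by (intro measurable_component_singleton) simp
  have "indep_vars (\<lambda>i. ?N) (\<lambda>i x. x i) {..<d}"
  proof (subst indep_vars_iff_distr_eq_PiM')
    show "distr (gauss d) (Pi\<^sub>M {..<d} (\<lambda>i. ?N)) (\<lambda>x. \<lambda>i\<in>{..<d}. x i) =
      Pi\<^sub>M {..<d} (\<lambda>i. distr (gauss d) ?N (\<lambda>x. x i))"
    proof -
      have "distr (gauss d) ?N (\<lambda>x. x i) = ?N" if "i \<in> {..<d}" for i
        unfolding gauss_def using that prob_space_normal_density[of 1 0]
        by (intro distr_PiM_component) auto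
      then have "Pi\<^sub>M {..<d} (\<lambda>i. distr (gauss d) ?N (\<lambda>x. x i)) = gauss d"
        unfolding gauss_def by (intro PiM_cong) (auto simp: gauss_def)
      \<comment> \<open>Points of a product space are extensional, so restriction to
        \<open>{..<d}\<close> acts as the identity on them.\<close>
      moreover have "distr (gauss d) (Pi\<^sub>M {..<d} (\<lambda>i. ?N)) (\<lambda>x. \<lambda>i\<in>{..<d}. x i) = distr (gauss d) (gauss d) (\<lambda>x. x)"
        by (intro distr_cong) (auto simp: gauss_def space_PiM)
      ultimately show ?thesis by (simp add: distr_id2)
    qed
  qed (use assms meas in auto)
  then have "indep_vars (\<lambda>i. borel) (\<lambda>i x. (\<lambda>t. t) (x i)) {..<d}"
    by (rule indep_vars_compose2) auto
  then show ?thesis using assms by (auto intro: indep_vars_subset)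
qed

text \<open>Independent centred normals add up to a normal variable, and the variances
  \<open>(a i)\<^sup>2\<close> sum to 1.\<close>

lemma distributed_gauss_linear:
  fixes a :: "nat \<Rightarrow> real"
  assumes "(\<Sum>i<d. (a i)\<^sup>2) = 1"
  shows "distributed (gauss d) lborel (\<lambda>x. \<Sum>i<d. a i * x i) std_normal_density"
proof -
  interpret prob_space "gauss d" by (rule prob_space_gauss)
  \<comment> \<open>Normal densities require positive deviation, so indices with zero coefficient
    are dropped.\<close>
  define I where "I = {i. i < d \<and> a i \<noteq> 0}"
  have I: "I \<subseteq> {..<d}" "finite I" by (auto simp: I_def)
  have sumI: "(\<Sum>i<d. f i) = (\<Sum>i\<in>I. f i)" if "\<And>i. a i = 0 \<Longrightarrow> f i = 0" for f :: "nat \<Rightarrow> real"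
    using that by (intro sum.mono_neutral_right) (auto simp: I_def)
  have "I \<noteq> {}" using assms sumI[of "\<lambda>i. (a i)\<^sup>2"] by auto
  have "distributed (gauss d) lborel (\<lambda>x. \<Sum>i\<in>I. a i * x i)
      (normal_density (\<Sum>i\<in>I. 0) (sqrt (\<Sum>i\<in>I. \<bar>a i\<bar>\<^sup>2)))"
  proof (rule sum_indep_normal[OF \<open>finite I\<close> \<open>I \<noteq> {}\<close>])
    have "indep_vars (\<lambda>i. borel) (\<lambda>i x. (\<lambda>t. a i * t) (x i)) I"
      by (rule indep_vars_compose2[OF indep_gauss_components[OF I(1) \<open>I \<noteq> {}\<close>]]) auto
    then show "indep_vars (\<lambda>i. borel) (\<lambda>i x. a i * x i) I" by simp
  next
    fix i assume "i \<in> I"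
    then show "0 < \<bar>a i\<bar>" by (auto simp: I_def)
    show "distributed (gauss d) lborel (\<lambda>x. a i * x i) (normal_density 0 \<bar>a i\<bar>)"
      using normal_density_affine[of "\<lambda>x. x i" 0 1 "a i" 0] distributed_gauss_component[of i d] \<open>i \<in> I\<close>
      by (auto simp: I_def)
  qed
  then show ?thesis using assms by (simp add: sumI)
qed

text \<open>The constant \<open>225\<close> is \<open>(3 \<cdot> 5)\<^sup>2\<close>, where \<open>5\<close> bounds the expectation of \<open>\<bar>g\<bar>\<^bsup>-1/2\<^esup>\<close> and two averaging
  arguments are combined by Markov's inequality at level \<open>1/3\<close>.\<close>

lemma exists_common_large_point:
  fixes a :: "nat \<Rightarrow> nat \<Rightarrow> real"
  assumes "0 < d" "0 < k" and unit: "\<And>j. j < n \<Longrightarrow> (\<Sum>i<d. (a j i)\<^sup>2) = 1"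
  shows "\<exists>x. (1 / 225) ^ n \<le> (\<Prod>j<n. \<bar>\<Sum>i<d. a j i * x i\<bar>) \<and>
    (\<Sum>i<d. x i ^ (2 * k)) \<le> 3 * real d * real ((2 * k) ^ k)"
proof -
  interpret prob_space "gauss d" by (rule prob_space_gauss)
  define Y where "Y j x = (\<Sum>i<d. a j i * x i)" for j x
  define m where "m = real ((2 * k) ^ k)"
  have "0 < m" using \<open>0 < k\<close> by (simp add: m_def)
  have Y: "distributed (gauss d) lborel (Y j) std_normal_density" if "j < n" for j
    unfolding Y_def using distributed_gauss_linear unit that by blast
  have meas [measurable]: "Y j \<in> borel_measurable (gauss d)" if "j \<in> {..<n}" for j
    using Y[of j] that by (simp add: distributed_def)
  have measX [measurable]: "(\<lambda>x. x i) \<in> borel_measurable (gauss d)" if "i \<in> {..<d}" for i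
    using distributed_gauss_component[of i d] that by (simp add: distributed_def)
  have EY: "(\<integral>\<^sup>+x. inv_sqrt_abs (Y j x) \<partial>gauss d) \<le> 5" if "j < n" for j
    using distributed_nn_integral[OF Y[OF that], of inv_sqrt_abs] nn_integral_normal_inv_sqrt_abs by simp
  have EX: "(\<integral>\<^sup>+x. ennreal (x i ^ (2 * k)) \<partial>gauss d) \<le> ennreal m" if "i < d" for i
    using distributed_nn_integral[OF distributed_gauss_component[OF that], of "\<lambda>t. ennreal (t ^ (2 * k))"]
      nn_integral_normal_even_moment[of k] by (simp add: m_def)
  define F where "F x = (\<Sum>j<n. inv_sqrt_abs (Y j x))" for x
  define G where "G x = (\<Sum>i<d. ennreal (x i ^ (2 * k)))" for x :: "nat \<Rightarrow> real"
  have [measurable]: "F \<in> borel_measurable (gauss d)" "G \<in> borel_measurable (gauss d)"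
    unfolding F_def G_def by measurable
  have "(\<integral>\<^sup>+x. F x \<partial>gauss d) \<le> (\<Sum>j<n. 5)"
    unfolding F_def by (subst nn_integral_sum) (auto intro!: sum_mono EY simp del: sum_constant)
  then have EF: "(\<integral>\<^sup>+x. F x \<partial>gauss d) \<le> ennreal (5 * n)"
    by (simp add: ennreal_mult' ennreal_of_nat_eq_real_of_nat mult.commute)
  have "(\<integral>\<^sup>+x. G x \<partial>gauss d) \<le> (\<Sum>i<d. ennreal m)"
    unfolding G_def by (subst nn_integral_sum) (auto intro!: sum_mono EX simp del: sum_constant)
  then have EG: "(\<integral>\<^sup>+x. G x \<partial>gauss d) \<le> ennreal (d * m)"
    by (simp add: ennreal_mult' ennreal_of_nat_eq_real_of_nat)
  have "\<exists>x. F x \<le> ennreal (15 * n) \<and> G x \<le> ennreal (3 * (d * m))"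
  proof (rule ccontr)
    assume no: "\<not> ?thesis"
    \<comment> \<open>With both parts scaled to mean at most 1, \<open>?u\<close> has expectation at
      most 2; if every point failed one of the two bounds, \<open>?u\<close> would be at least 3
      everywhere.\<close>
    let ?u = "\<lambda>x. ennreal (1 / (5 * n)) * F x + ennreal (1 / (d * m)) * G x"
    have "3 \<le> ?u x" for x
    proof -
      have "ennreal (15 * n) < F x \<or> ennreal (3 * (d * m)) < G x" using no by (auto simp: not_le)
      then show ?thesis
      proof
        assume *: "ennreal (15 * n) < F x"
        then have "n \<noteq> 0" by (cases n) (auto simp: F_def)
        then have "3 = ennreal (1 / (5 * n)) * ennreal (15 * n)"
          by (simp add: ennreal_mult[symmetric])
        also have "\<dots> \<le> ennreal (1 / (5 * n)) * F x" using * by (intro mult_left_mono) auto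
        finally show ?thesis by (rule order_trans) simp
      next
        assume *: "ennreal (3 * (d * m)) < G x"
        have "3 = ennreal (1 / (d * m)) * ennreal (3 * (d * m))"
          using \<open>0 < d\<close> \<open>0 < m\<close> by (simp add: ennreal_mult[symmetric])
        also have "\<dots> \<le> ennreal (1 / (d * m)) * G x" using * by (intro mult_left_mono) auto
        finally show ?thesis by (rule order_trans) simp
      qed
    qed
    then have "(\<integral>\<^sup>+x. 3 \<partial>gauss d) \<le> (\<integral>\<^sup>+x. ?u x \<partial>gauss d)" by (intro nn_integral_mono)
    also have "\<dots> = ennreal (1 / (5 * n)) * (\<integral>\<^sup>+x. F x \<partial>gauss d) + ennreal (1 / (d * m)) * (\<integral>\<^sup>+x. G x \<partial>gauss d)"
      by (simp add: nn_integral_add nn_integral_cmult)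
    also have "\<dots> \<le> ennreal (1 / (5 * n)) * ennreal (5 * n) + ennreal (1 / (d * m)) * ennreal (d * m)"
      using EF EG by (intro add_mono mult_left_mono) auto
    \<comment> \<open>Only an inequality: for \<open>n = 0\<close> the first product is 0, as
      \<open>1 / 0 = 0\<close>.\<close>
    also have "\<dots> \<le> ennreal 1 + ennreal 1"
      using \<open>0 < m\<close> by (intro add_mono) (auto simp: ennreal_mult[symmetric] intro!: ennreal_leI)
    finally show False by (simp add: emeasure_space_1)
  qed
  then obtain x where F: "F x \<le> ennreal (15 * n)" and G: "G x \<le> ennreal (3 * (d * m))" by blast
  \<comment> \<open>A vanishing form would make \<open>F x\<close> infinite; here the value
    \<open>\<infinity>\<close> of \<open>inv_sqrt_abs\<close> at 0 pays off.\<close>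
  have Y0: "Y j x \<noteq> 0" if "j < n" for j
  proof
    assume "Y j x = 0"
    moreover have "inv_sqrt_abs (Y j x) \<le> F x"
      unfolding F_def using that by (intro member_le_sum) auto
    ultimately have "\<infinity> \<le> F x" by (simp add: inv_sqrt_abs_def)
    also note F
    finally show False by (simp add: top_unique)
  qed
  have "F x = ennreal (\<Sum>j<n. \<bar>Y j x\<bar> powr (-1/2))"
    unfolding F_def using Y0 by (subst sum_ennreal[symmetric]) (auto simp: inv_sqrt_abs_def)
  with F have "(\<Sum>j<n. \<bar>Y j x\<bar> powr (-1/2)) \<le> real (card {..<n}) * 15" by simp
  then have "(\<Prod>j<n. \<bar>Y j x\<bar> powr (-1/2)) \<le> 15 ^ card {..<n}"
    by (intro prod_le_power_of_sum_le) auto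
  moreover define P where "P = (\<Prod>j<n. \<bar>Y j x\<bar>)"
  ultimately have "P powr (-1/2) \<le> 15 ^ n"
    by (simp add: prod_powr_distrib)
  moreover have "0 < P" unfolding P_def using Y0 by (intro prod_pos) auto
  ultimately have "(15 ^ n) powr (-2) \<le> (P powr (-1/2)) powr (-2)"
    by (intro powr_mono2') auto
  also have "\<dots> = P" using \<open>0 < P\<close> by (simp add: powr_powr)
  also have "(15 ^ n) powr (-2::real) = (1 / 225) ^ n"
    using power_mult[of "15::real" n 2] power_mult[of "15::real" 2 n]
    by (simp add: powr_minus mult.commute inverse_eq_divide power_one_over)
  finally have "(1 / 225) ^ n \<le> P" .
  moreover have "G x = ennreal (\<Sum>i<d. x i ^ (2 * k))"
    unfolding G_def by (simp add: zero_le_even_power)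
  with G have "(\<Sum>i<d. x i ^ (2 * k)) \<le> 3 * (d * m)" using \<open>0 < m\<close> by simp
  ultimately show ?thesis unfolding P_def Y_def m_def by (auto simp: mult.assoc intro!: exI[of _ x])
qed

subsection \<open>The product constants of a finite-dimensional norm\<close>

lemma zero_in_vecs: "(\<lambda>i. 0) \<in> vecs d"
  by (simp add: vecs_def)

lemma scale_in_vecs: "x \<in> vecs d \<Longrightarrow> (\<lambda>i. c * x i) \<in> vecs d"
  by (simp add: vecs_def)

lemma dualsp_scale: "\<psi> \<in> dualsp d \<Longrightarrow> x \<in> vecs d \<Longrightarrow> \<psi> (\<lambda>i. c * x i) = c * \<psi> x"
  by (simp add: dualsp_def)

lemma dualsp_add: "\<psi> \<in> dualsp d \<Longrightarrow> x \<in> vecs d \<Longrightarrow> y \<in> vecs d \<Longrightarrow> \<psi> (\<lambda>i. x i + y i) = \<psi> x + \<psi> y"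
  by (simp add: dualsp_def)

lemma linear_form_in_dualsp: "(\<lambda>x. \<Sum>i<d. x i * b i) \<in> dualsp d"
  by (simp add: dualsp_def sum.distrib sum_distrib_left algebra_simps)

abbreviation basis_vec :: "nat \<Rightarrow> nat \<Rightarrow> 'k::real_normed_field" where
  "basis_vec i \<equiv> (\<lambda>j. if j = i then 1 else 0)"

text \<open>Linearity is available inside \<open>vecs d\<close> only, so the induction runs over
  truncations of \<open>x\<close>, which stay there.\<close>

lemma dualsp_expand:
  fixes x :: "nat \<Rightarrow> 'a::real_normed_field"
  assumes \<psi>: "\<psi> \<in> dualsp d" and "x \<in> vecs d"
  shows "\<psi> x = (\<Sum>i<d. x i * \<psi> (basis_vec i))"
proof -
  have "\<psi> (\<lambda>j. if j < m then x j else 0) = (\<Sum>i<m. x i * \<psi> (basis_vec i))" if "m \<le> d" for m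
    using that
  proof (induction m)
    case 0
    have "\<psi> (\<lambda>j. 0 * 0) = 0 * \<psi> (\<lambda>j. 0)" by (rule dualsp_scale[OF \<psi> zero_in_vecs])
    then show ?case by simp
  next
    case (Suc m)
    let ?y = "\<lambda>j. if j < m then x j else 0"
    have y: "?y \<in> vecs d" and e: "basis_vec m \<in> (vecs d :: (nat \<Rightarrow> 'a) set)"
      using Suc.prems by (auto simp: vecs_def)
    have "(\<lambda>j. if j < Suc m then x j else 0)
        = (\<lambda>j. (if j < m then x j else 0) + x m * basis_vec m j)"
      by (auto simp: less_Suc_eq)
    then have "\<psi> (\<lambda>j. if j < Suc m then x j else 0) = \<psi> ?y + \<psi> (\<lambda>j. x m * basis_vec m j)"
      using dualsp_add[OF \<psi> y scale_in_vecs[OF e]] by simp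
    also have "\<psi> (\<lambda>j. x m * basis_vec m j) = x m * \<psi> (basis_vec m)"
      by (rule dualsp_scale[OF \<psi> e])
    finally show ?case using Suc by simp
  qed
  moreover have "(\<lambda>j. if j < d then x j else 0) = x" using \<open>x \<in> vecs d\<close> by (auto simp: vecs_def)
  ultimately show ?thesis by fastforce
qed

definition admissible :: "((nat \<Rightarrow> 'k::real_normed_field) \<Rightarrow> real) \<Rightarrow> nat \<Rightarrow> nat \<Rightarrow> real set" where
  "admissible N d n = {C. 0 \<le> C \<and> (\<forall>\<psi>::nat \<Rightarrow> (nat \<Rightarrow> 'k) \<Rightarrow> 'k. (\<forall>i<n. \<psi> i \<in> dualsp d) \<longrightarrow>
        (\<Prod>i<n. fnorm N d (\<psi> i)) \<le> C * fnorm N d (\<lambda>x. \<Prod>i<n. \<psi> i x))}"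

lemma cn_eq_Inf_admissible: "cn N d n = Inf (admissible N d n)"
  by (simp add: cn_def admissible_def)

lemma bdd_below_admissible: "bdd_below (admissible N d n)"
  by (intro bdd_belowI[of _ 0]) (simp add: admissible_def)

lemma admissibleD:
  "C \<in> admissible N d n \<Longrightarrow> (\<And>i. i < n \<Longrightarrow> \<psi> i \<in> dualsp d) \<Longrightarrow>
    (\<Prod>i<n. fnorm N d (\<psi> i)) \<le> C * fnorm N d (\<lambda>x. \<Prod>i<n. \<psi> i x)"
  by (auto simp: admissible_def)

text \<open>\<open>S\<close> bounds the Euclidean norm on the unit sphere of \<open>N\<close>. It
  links \<open>N\<close> to the Euclidean geometry of Gaussian vectors and makes all functionals
  bounded on the sphere.\<close>

locale coordinate_norm =
  fixes N :: "(nat \<Rightarrow> 'k::real_normed_field) \<Rightarrow> real" and d :: nat and S :: real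
  assumes dim_pos: "0 < d" and S_pos: "0 < S"
    and norm_scale: "x \<in> vecs d \<Longrightarrow> N (\<lambda>i. c * x i) = norm c * N x"
    and norm_pos: "x \<in> vecs d \<Longrightarrow> x \<noteq> (\<lambda>i. 0) \<Longrightarrow> 0 < N x"
    and sphere_le: "x \<in> vecs d \<Longrightarrow> N x = 1 \<Longrightarrow> sqrt (\<Sum>i<d. (norm (x i))\<^sup>2) \<le> S"
begin

definition sphere :: "(nat \<Rightarrow> 'k) set" where
  "sphere = {x \<in> vecs d. N x = 1}"

lemma normalize_in_sphere:
  assumes "x \<in> vecs d" "x \<noteq> (\<lambda>i. 0)"
  shows "(\<lambda>i. of_real (1 / N x) * x i) \<in> sphere"
  using norm_pos[OF assms] assms
  by (simp only: sphere_def mem_Collect_eq norm_scale scale_in_vecs) (simp add: norm_divide)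

lemma sphere_nonempty: "sphere \<noteq> {}"
proof -
  have "(basis_vec 0 :: nat \<Rightarrow> 'k) \<in> vecs d" "basis_vec 0 \<noteq> (\<lambda>i. 0 :: 'k)"
    using dim_pos by (auto simp: vecs_def fun_eq_iff)
  from normalize_in_sphere[OF this] show ?thesis by blast
qed

text \<open>A real supremum such as \<open>fnorm\<close> is informative only over a set bounded
  above, so this is tracked separately.\<close>

definition bounded_on_sphere :: "((nat \<Rightarrow> 'k) \<Rightarrow> 'k) \<Rightarrow> bool" where
  "bounded_on_sphere f \<longleftrightarrow> bdd_above ((\<lambda>x. norm (f x)) ` sphere)"

lemma bounded_on_sphereI: "(\<And>x. x \<in> sphere \<Longrightarrow> norm (f x) \<le> B) \<Longrightarrow> bounded_on_sphere f"
  unfolding bounded_on_sphere_def by (intro bdd_aboveI2)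

lemma fnorm_upper: "bounded_on_sphere f \<Longrightarrow> x \<in> sphere \<Longrightarrow> norm (f x) \<le> fnorm N d f"
  unfolding bounded_on_sphere_def fnorm_def sphere_def[symmetric] by (rule cSUP_upper)

lemma fnorm_least: "(\<And>x. x \<in> sphere \<Longrightarrow> norm (f x) \<le> B) \<Longrightarrow> fnorm N d f \<le> B"
  unfolding fnorm_def sphere_def[symmetric] using sphere_nonempty by (rule cSUP_least)

lemma fnorm_nonneg: "bounded_on_sphere f \<Longrightarrow> 0 \<le> fnorm N d f"
  using sphere_nonempty fnorm_upper[of f] norm_ge_zero[of "f _"] by (metis ex_in_conv order_trans)

lemma bounded_on_sphere_mult:
  assumes "bounded_on_sphere f" "bounded_on_sphere g"
  shows "bounded_on_sphere (\<lambda>x. f x * g x)"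
  by (rule bounded_on_sphereI[of _ "fnorm N d f * fnorm N d g"])
    (auto simp: norm_mult intro!: mult_mono fnorm_upper fnorm_nonneg assms)

lemma fnorm_mult_le:
  assumes "bounded_on_sphere f" "bounded_on_sphere g"
  shows "fnorm N d (\<lambda>x. f x * g x) \<le> fnorm N d f * fnorm N d g"
  by (rule fnorm_least) (auto simp: norm_mult intro!: mult_mono fnorm_upper fnorm_nonneg assms)

lemma bounded_on_sphere_prod:
  assumes "finite I" "\<And>i. i \<in> I \<Longrightarrow> bounded_on_sphere (f i)"
  shows "bounded_on_sphere (\<lambda>x. \<Prod>i\<in>I. f i x)"
  using assms
  by (induction I rule: finite_induct) (auto intro: bounded_on_sphere_mult bounded_on_sphereI[of _ 1])

lemma norm_dualsp_le:
  assumes "\<psi> \<in> dualsp d" "x \<in> sphere"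
  shows "norm (\<psi> x) \<le> S * sqrt (\<Sum>i<d. (norm (\<psi> (basis_vec i)))\<^sup>2)"
proof -
  have "norm (\<psi> x) \<le> sqrt (\<Sum>i<d. (norm (\<psi> (basis_vec i)))\<^sup>2) * sqrt (\<Sum>i<d. (norm (x i))\<^sup>2)"
    using assms dualsp_expand[of \<psi> d x] cauchy_schwarz_sum_mult[of x "\<lambda>i. \<psi> (basis_vec i)" "{..<d}"]
    by (simp add: sphere_def)
  also have "\<dots> \<le> sqrt (\<Sum>i<d. (norm (\<psi> (basis_vec i)))\<^sup>2) * S"
    using assms sphere_le[of x] by (intro mult_left_mono) (auto simp: sphere_def sum_nonneg)
  finally show ?thesis by (simp add: mult.commute)
qed

lemma bounded_on_sphere_dualsp: "\<psi> \<in> dualsp d \<Longrightarrow> bounded_on_sphere \<psi>"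
  using norm_dualsp_le by (rule bounded_on_sphereI)

lemma fnorm_ge_quotient:
  assumes "\<psi> \<in> dualsp d" "x \<in> vecs d" "x \<noteq> (\<lambda>i. 0)"
  shows "norm (\<psi> x) / N x \<le> fnorm N d \<psi>"
proof -
  have "norm (\<psi> (\<lambda>i. of_real (1 / N x) * x i)) \<le> fnorm N d \<psi>"
    using assms by (intro fnorm_upper bounded_on_sphere_dualsp normalize_in_sphere)
  then show ?thesis
    using assms norm_pos[of x] by (simp only: dualsp_scale norm_mult) (simp add: norm_divide)
qed

lemma exists_nonzero_functional: "\<exists>\<phi>\<in>dualsp d. 0 < fnorm N d \<phi>"
proof -
  let ?\<phi> = "\<lambda>x. \<Sum>i<d. x i * (if i = 0 then 1 else 0)"
  have "(basis_vec 0 :: nat \<Rightarrow> 'k) \<in> vecs d" "basis_vec 0 \<noteq> (\<lambda>i. 0 :: 'k)"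
    using dim_pos by (auto simp: vecs_def fun_eq_iff)
  with fnorm_ge_quotient[OF linear_form_in_dualsp[where b = "\<lambda>i. if i = 0 then 1 else 0"] this] norm_pos[OF this]
  have "0 < fnorm N d ?\<phi>"
    using dim_pos by (auto simp: if_distrib cong: if_cong elim!: less_le_trans[rotated])
  then show ?thesis using linear_form_in_dualsp[where b = "basis_vec 0" and d = d] by blast
qed

lemma fnorm_power_le:
  assumes "bounded_on_sphere f"
  shows "fnorm N d (\<lambda>x. f x ^ n) \<le> fnorm N d f ^ n"
  by (rule fnorm_least) (auto simp: norm_power intro!: power_mono fnorm_upper assms)

text \<open>Test on \<open>n\<close> copies of one functional of positive norm.\<close>

lemma one_le_admissible:
  assumes "C \<in> admissible N d n"
  shows "1 \<le> C"
proof -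
  obtain \<phi> where \<phi>: "\<phi> \<in> dualsp d" "0 < fnorm N d \<phi>" using exists_nonzero_functional by blast
  have "fnorm N d \<phi> ^ n \<le> C * fnorm N d (\<lambda>x. \<phi> x ^ n)"
    using admissibleD[OF assms, of "\<lambda>_. \<phi>"] \<phi> by simp
  also have "\<dots> \<le> C * fnorm N d \<phi> ^ n"
    using assms \<phi> by (intro mult_left_mono fnorm_power_le bounded_on_sphere_dualsp) (auto simp: admissible_def)
  finally show ?thesis using \<phi> by simp
qed

end

text \<open>The bound makes \<open>admissible\<close> nonempty, so that \<open>cn\<close> is a
  genuine infimum, and its exponential form bounds the \<open>n\<close>-th roots by
  \<open>M\<close>.\<close>

locale polynomially_bounded_norm = coordinate_norm N d S
  for N :: "(nat \<Rightarrow> 'k::real_normed_field) \<Rightarrow> real" and d S +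
  fixes M :: real
  assumes power_admissible: "M ^ n \<in> admissible N d n"
begin

lemma cn_le_power: "cn N d n \<le> M ^ n"
  unfolding cn_eq_Inf_admissible using power_admissible bdd_below_admissible by (rule cInf_lower)

lemma cn_greatest: "(\<And>C. C \<in> admissible N d n \<Longrightarrow> B \<le> C) \<Longrightarrow> B \<le> cn N d n"
  unfolding cn_eq_Inf_admissible using power_admissible by (intro cInf_greatest) auto

lemma one_le_cn: "1 \<le> cn N d n"
  using one_le_admissible by (rule cn_greatest)

text \<open>Concatenation without optimal families: for \<open>C\<close> admissible at
  \<open>m + n\<close> and fixed \<open>\<phi>\<close>, the number
  \<open>C * fnorm N d \<Phi> / b\<close> is admissible at \<open>m\<close>, hence at least
  \<open>cn N d m\<close>. Solving for \<open>b\<close> shows that \<open>C / cn N d m\<close> is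
  admissible at \<open>n\<close>. The case \<open>b = 0\<close> is separate because of the
  division.\<close>

lemma cn_supermultiplicative: "cn N d m * cn N d n \<le> cn N d (m + n)"
proof (rule cn_greatest)
  fix C assume C: "C \<in> admissible N d (m + n)"
  have C0: "0 \<le> C" using C by (simp add: admissible_def)
  have cm: "0 < cn N d m" using one_le_cn[of m] by linarith
  have "C / cn N d m \<in> admissible N d n"
    unfolding admissible_def
  proof (intro CollectI conjI allI impI)
    fix \<phi> :: "nat \<Rightarrow> (nat \<Rightarrow> 'k) \<Rightarrow> 'k" assume "\<forall>i<n. \<phi> i \<in> dualsp d"
    then have \<phi>: "\<phi> i \<in> dualsp d" if "i < n" for i using that by blast
    define \<Phi> where "\<Phi> x = (\<Prod>i<n. \<phi> i x)" for x
    define b where "b = (\<Prod>i<n. fnorm N d (\<phi> i))"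
    have bdd\<Phi>: "bounded_on_sphere \<Phi>"
      unfolding \<Phi>_def using \<phi> by (intro bounded_on_sphere_prod bounded_on_sphere_dualsp) auto
    have "b \<le> C / cn N d m * fnorm N d \<Phi>"
    proof (cases "b = 0")
      case True
      then show ?thesis using C0 cm fnorm_nonneg[OF bdd\<Phi>] by simp
    next
      case False
      then have b: "0 < b"
        unfolding b_def using \<phi> by (intro order.not_eq_order_implies_strict prod_nonneg)
          (auto intro: fnorm_nonneg bounded_on_sphere_dualsp)
      have "C * fnorm N d \<Phi> / b \<in> admissible N d m"
        unfolding admissible_def
      proof (intro CollectI conjI allI impI)
        show "0 \<le> C * fnorm N d \<Phi> / b" using C0 b fnorm_nonneg[OF bdd\<Phi>] by simp
        fix \<psi> :: "nat \<Rightarrow> (nat \<Rightarrow> 'k) \<Rightarrow> 'k" assume "\<forall>i<m. \<psi> i \<in> dualsp d"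
        then have \<psi>: "\<psi> i \<in> dualsp d" if "i < m" for i using that by blast
        let ?\<chi> = "\<lambda>i. if i < m then \<psi> i else \<phi> (i - m)"
        \<comment> \<open>Arbitrary \<open>h\<close>, since the splitting serves both the norms and
          the values at a point.\<close>
        have split: "(\<Prod>i<m + n. h (?\<chi> i)) = (\<Prod>i<m. h (\<psi> i)) * (\<Prod>i<n. h (\<phi> i))"
          for h :: "((nat \<Rightarrow> 'k) \<Rightarrow> 'k) \<Rightarrow> 'b::comm_monoid_mult"
        proof -
          have "(\<Prod>i<m + n. h (?\<chi> i)) = (\<Prod>i<m. h (?\<chi> i)) * (\<Prod>i<n. h (?\<chi> (i + m)))"
            by (induction n) (simp_all add: mult.assoc add.commute)
          then show ?thesis by simp
        qed
        have "(\<Prod>i<m. fnorm N d (\<psi> i)) * b \<le> C * fnorm N d (\<lambda>x. (\<Prod>i<m. \<psi> i x) * \<Phi> x)"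
          using admissibleD[OF C, of ?\<chi>] \<psi> \<phi> split[of "fnorm N d"] split[of "\<lambda>f. f _"]
          by (simp add: b_def \<Phi>_def)
        also have "\<dots> \<le> C * (fnorm N d (\<lambda>x. \<Prod>i<m. \<psi> i x) * fnorm N d \<Phi>)"
          using \<psi> C0 bdd\<Phi>
          by (intro mult_left_mono fnorm_mult_le[OF _ bdd\<Phi>] bounded_on_sphere_prod bounded_on_sphere_dualsp) auto
        finally show "(\<Prod>i<m. fnorm N d (\<psi> i)) \<le> C * fnorm N d \<Phi> / b * fnorm N d (\<lambda>x. \<Prod>i<m. \<psi> i x)"
          using b by (simp add: field_simps)
      qed
      then have "cn N d m \<le> C * fnorm N d \<Phi> / b"
        unfolding cn_eq_Inf_admissible using bdd_below_admissible by (rule cInf_lower)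
      then show ?thesis using b cm by (simp add: field_simps)
    qed
    then show "(\<Prod>i<n. fnorm N d (\<phi> i)) \<le> C / cn N d m * fnorm N d (\<lambda>x. \<Prod>i<n. \<phi> i x)"
      by (simp add: b_def \<Phi>_def[abs_def])
  qed (use C0 cm in auto)
  then have "cn N d n \<le> C / cn N d m"
    unfolding cn_eq_Inf_admissible using bdd_below_admissible by (rule cInf_lower)
  then show "cn N d m * cn N d n \<le> C" using cm by (simp add: field_simps)
qed

lemma one_le_M: "1 \<le> M"
  using one_le_admissible[OF power_admissible[of 1]] by simp

text \<open>Logarithms turn supermultiplicativity into superadditivity. Fekete's lemma then yields
  convergence, so \<open>lim\<close> in \<open>cconst\<close> is a true limit.\<close>

lemma cconst_bounds:
  shows cconst_le: "cconst N d \<le> M"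
    and cn_root_le_cconst: "0 < n \<Longrightarrow> cn N d n powr (1 / real n) \<le> cconst N d"
proof -
  define b where "b n = ln (cn N d n)" for n
  have pos: "0 < cn N d n" for n using one_le_cn[of n] by linarith
  have bound: "b n \<le> real n * ln M" for n
  proof -
    have "b n \<le> ln (M ^ n)"
      unfolding b_def by (intro ln_mono cn_le_power pos)
    also have "\<dots> = real n * ln M" by (rule ln_realpow)
    finally show ?thesis .
  qed
  have nonneg: "0 \<le> b n" for n using one_le_cn by (simp add: b_def)
  have lim: "(\<lambda>n. b n / real n) \<longlonglongrightarrow> (SUP n\<in>{0<..}. b n / real n)"
  proof (rule superadditive_quotient_tendsto[OF _ nonneg bound])
    fix m n
    have "b m + b n = ln (cn N d m * cn N d n)"
      unfolding b_def by (rule ln_mult_pos[OF pos pos, symmetric])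
    also have "\<dots> \<le> b (m + n)"
      unfolding b_def by (intro ln_mono cn_supermultiplicative pos mult_pos_pos)
    finally show "b m + b n \<le> b (m + n)" .
  qed
  have "(\<lambda>n. cn N d n powr (1 / real n)) = (\<lambda>n. exp (b n / real n))"
    using pos by (auto simp: b_def powr_def less_imp_neq[THEN not_sym])
  then have "(\<lambda>n. cn N d n powr (1 / real n)) \<longlonglongrightarrow> exp (SUP n\<in>{0<..}. b n / real n)"
    using tendsto_exp[OF lim] by simp
  then have eq: "cconst N d = exp (SUP n\<in>{0<..}. b n / real n)"
    unfolding cconst_def by (rule limI)
  have le: "b n / real n \<le> ln M" if "0 < n" for n using bound[of n] that by (simp add: field_simps)
  have "(SUP n\<in>{0<..}. b n / real n) \<le> ln M" using le by (intro cSUP_least) auto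
  then have "exp (SUP n\<in>{0<..}. b n / real n) \<le> exp (ln M)" by simp
  then show "cconst N d \<le> M" unfolding eq using one_le_M by simp
  assume "0 < n"
  have "b n / real n \<le> (SUP n\<in>{0<..}. b n / real n)"
    using le \<open>0 < n\<close> by (intro cSUP_upper bdd_aboveI2[of _ _ "ln M"]) auto
  then show "cn N d n powr (1 / real n) \<le> cconst N d"
    unfolding eq using pos[of n] by (simp add: b_def powr_def)
qed

text \<open>Lower bound from a single family: the norms are at least \<open>A\<close>, and AM-GM
  bounds the product by \<open>B ^ card I\<close> on the sphere. One value of \<open>n\<close>
  suffices, because every root of \<open>cn\<close> lies below \<open>cconst\<close>.\<close>

lemma quotient_le_cconst:
  fixes \<psi> :: "'i \<Rightarrow> (nat \<Rightarrow> 'k) \<Rightarrow> 'k"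
  assumes I: "finite I" "I \<noteq> {}" and \<psi>: "\<And>i. i \<in> I \<Longrightarrow> \<psi> i \<in> dualsp d"
    and A: "0 \<le> A" "\<And>i. i \<in> I \<Longrightarrow> A \<le> fnorm N d (\<psi> i)" and "0 < B" "0 < r"
    and mean: "\<And>x. x \<in> sphere \<Longrightarrow> (\<Sum>i\<in>I. norm (\<psi> i x) powr r) \<le> real (card I) * B powr r"
  shows "A / B \<le> cconst N d"
proof -
  obtain h where h: "bij_betw h {..<card I} I"
    using ex_bij_betw_nat_finite[OF \<open>finite I\<close>] by (auto simp: atLeast0LessThan)
  then have hI: "h j \<in> I" if "j < card I" for j using that by (auto simp: bij_betw_def)
  have n: "0 < card I" using I by (simp add: card_gt_0_iff)
  have "(A / B) ^ card I \<le> cn N d (card I)"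
  proof (rule cn_greatest)
    fix C assume C: "C \<in> admissible N d (card I)"
    then have "0 \<le> C" by (simp add: admissible_def)
    have "A ^ card I \<le> (\<Prod>j<card I. fnorm N d (\<psi> (h j)))"
      using prod_mono[of "{..<card I}" "\<lambda>_. A" "\<lambda>j. fnorm N d (\<psi> (h j))"] A hI by simp
    also have "\<dots> \<le> C * fnorm N d (\<lambda>x. \<Prod>j<card I. \<psi> (h j) x)"
      using \<psi> hI by (intro admissibleD[OF C]) auto
    also have "\<dots> \<le> C * B ^ card I"
    proof (intro mult_left_mono[OF fnorm_least \<open>0 \<le> C\<close>])
      fix x assume x: "x \<in> sphere"
      have "norm (\<Prod>j<card I. \<psi> (h j) x) = (\<Prod>i\<in>I. norm (\<psi> i x))"
        using prod.reindex_bij_betw[OF h, of "\<lambda>i. norm (\<psi> i x)"] by (simp add: prod_norm)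
      also have "\<dots> \<le> B ^ card I"
        using mean[OF x] \<open>0 < B\<close> \<open>0 < r\<close> I by (intro prod_le_power_of_sum_powr_le[of _ _ _ r]) auto
      finally show "norm (\<Prod>j<card I. \<psi> (h j) x) \<le> B ^ card I" .
    qed
    finally show "(A / B) ^ card I \<le> C" using \<open>0 < B\<close> by (simp add: field_simps)
  qed
  then have "((A / B) ^ card I) powr (1 / real (card I)) \<le> cn N d (card I) powr (1 / real (card I))"
    using A \<open>0 < B\<close> by (intro powr_mono2) auto
  also have "\<dots> \<le> cconst N d" using n by (rule cn_root_le_cconst)
  also have "((A / B) ^ card I) powr (1 / real (card I)) = A / B"
    using n A \<open>0 < B\<close> by (cases "A = 0") (auto simp: powr_realpow[symmetric] powr_powr)
  finally show ?thesis .
qed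

end

subsection \<open>Upper and lower bounds\<close>

text \<open>Some component carries at least the average share of the squared norm. This replaces
  scalar coefficients by real ones, as real Gaussian vectors require, at the price of a factor
  \<open>sqrt DIM('k)\<close>.\<close>

lemma exists_dominant_basis_projection:
  fixes b :: "nat \<Rightarrow> 'k::euclidean_space"
  shows "\<exists>u\<in>Basis. (\<Sum>i<d. (norm (b i))\<^sup>2) \<le> DIM('k) * (\<Sum>i<d. (b i \<bullet> u)\<^sup>2)"
proof (rule ccontr)
  assume no: "\<not> ?thesis"
  have "DIM('k) * (\<Sum>u\<in>Basis. \<Sum>i<d. (b i \<bullet> u)\<^sup>2) = (\<Sum>u\<in>Basis. DIM('k) * (\<Sum>i<d. (b i \<bullet> u)\<^sup>2))"
    by (rule sum_distrib_left)
  also have "\<dots> < (\<Sum>u\<in>(Basis::'k set). \<Sum>i<d. (norm (b i))\<^sup>2)"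
    by (rule sum_strict_mono) (use no in \<open>auto simp: not_le\<close>)
  also have "\<dots> = DIM('k) * (\<Sum>i<d. \<Sum>u\<in>Basis. (b i \<bullet> u)\<^sup>2)"
    by (simp add: norm_eq_sqrt_inner euclidean_inner[of "b _" "b _"] power2_eq_square sum_nonneg)
  also have "(\<Sum>i<d. \<Sum>u\<in>Basis. (b i \<bullet> u)\<^sup>2) = (\<Sum>u\<in>Basis. \<Sum>i<d. (b i \<bullet> u)\<^sup>2)"
    by (rule sum.swap)
  finally show False by simp
qed

text \<open>Each factor of the bound has its source: \<open>S\<close> compares functional norms with
  Euclidean ones, \<open>sqrt DIM('k)\<close> pays for passing to one component, \<open>225\<close>
  is the loss at the common point, and \<open>R\<close> is the cost of normalizing that point, once
  per functional.\<close>

lemma polynomially_bounded_normI: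
  fixes N :: "(nat \<Rightarrow> 'k::{real_normed_field,euclidean_space}) \<Rightarrow> real"
  assumes "coordinate_norm N d S" and "0 < R"
    and point: "\<And>n a. (\<And>j. j < n \<Longrightarrow> (\<Sum>i<d. (a j i)\<^sup>2) = 1) \<Longrightarrow>
      \<exists>x. (1 / 225) ^ n \<le> (\<Prod>j<n. \<bar>\<Sum>i<d. a j i * x i\<bar>) \<and>
        N (\<lambda>i. if i < d then of_real (x i) else 0) \<le> R"
  shows "polynomially_bounded_norm N d S (225 * sqrt DIM('k) * S * R)"
proof -
  interpret coordinate_norm N d S by fact
  let ?D = "sqrt DIM('k)"
  show ?thesis
  proof (unfold_locales, unfold admissible_def, intro CollectI conjI allI impI)
    fix n and \<psi> :: "nat \<Rightarrow> (nat \<Rightarrow> 'k) \<Rightarrow> 'k"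
    show "0 \<le> (225 * ?D * S * R) ^ n" using S_pos \<open>0 < R\<close> by simp
    assume "\<forall>i<n. \<psi> i \<in> dualsp d"
    then have \<psi>: "\<psi> j \<in> dualsp d" if "j < n" for j using that by blast
    define \<Psi> where "\<Psi> x = (\<Prod>j<n. \<psi> j x)" for x
    have bdd: "bounded_on_sphere \<Psi>"
      unfolding \<Psi>_def using \<psi> by (intro bounded_on_sphere_prod bounded_on_sphere_dualsp) auto
    define b where "b j i = \<psi> j (basis_vec i)" for j i
    define l where "l j = sqrt (\<Sum>i<d. (norm (b j i))\<^sup>2)" for j
    have fnorm_le: "fnorm N d (\<psi> j) \<le> S * l j" if "j < n" for j
      unfolding l_def b_def using \<psi>[OF that] norm_dualsp_le by (intro fnorm_least)
    have fnorm0: "0 \<le> fnorm N d (\<psi> j)" if "j < n" for j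
      using \<psi>[OF that] by (intro fnorm_nonneg bounded_on_sphere_dualsp)
    have "(\<Prod>j<n. fnorm N d (\<psi> j)) \<le> (225 * ?D * S * R) ^ n * fnorm N d \<Psi>"
    proof (cases "\<exists>j<n. l j = 0")
      \<comment> \<open>A functional with vanishing coefficients has norm 0, so the left-hand side
        is 0; otherwise all coefficient vectors can be normalized.\<close>
      case True
      then have zero: "(\<Prod>j<n. fnorm N d (\<psi> j)) = 0"
        using fnorm_le fnorm0 by (force intro!: prod_zero)
      show ?thesis unfolding zero using S_pos \<open>0 < R\<close> fnorm_nonneg[OF bdd] by simp
    next
      case l0: False
      have "\<forall>j. \<exists>u. u \<in> Basis \<and> (\<Sum>i<d. (norm (b j i))\<^sup>2) \<le> DIM('k) * (\<Sum>i<d. (b j i \<bullet> u)\<^sup>2)"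
        using exists_dominant_basis_projection unfolding Bex_def by (intro allI)
      from choice[OF this] obtain u where u: "u j \<in> Basis"
        "(\<Sum>i<d. (norm (b j i))\<^sup>2) \<le> DIM('k) * (\<Sum>i<d. (b j i \<bullet> u j)\<^sup>2)" for j
        by auto
      define s where "s j = sqrt (\<Sum>i<d. (b j i \<bullet> u j)\<^sup>2)" for j
      have ls: "l j \<le> ?D * s j" for j
        using u(2)[of j] by (simp add: l_def s_def real_sqrt_mult[symmetric])
      have s_pos: "0 < s j" if "j < n" for j
      proof -
        have "0 < l j" using l0 that by (auto simp: l_def sum_nonneg order.not_eq_order_implies_strict)
        with ls[of j] have "0 < ?D * s j" by linarith
        then show ?thesis by (simp add: zero_less_mult_iff)
      qed
      define a where "a j i = (b j i \<bullet> u j) / s j" for j i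
      have "(\<Sum>i<d. (a j i)\<^sup>2) = 1" if "j < n" for j
      proof -
        have "(\<Sum>i<d. (a j i)\<^sup>2) = (s j)\<^sup>2 / (s j)\<^sup>2"
          by (simp add: a_def power_divide sum_divide_distrib[symmetric] s_def sum_nonneg)
        then show ?thesis using s_pos[OF that] by simp
      qed
      then obtain x where x: "(1 / 225) ^ n \<le> (\<Prod>j<n. \<bar>\<Sum>i<d. a j i * x i\<bar>)"
        and Nx: "N (\<lambda>i. if i < d then of_real (x i) else 0) \<le> R"
        using point[of n a] by blast
      define y where "y = (\<lambda>i. if i < d then of_real (x i) else (0::'k))"
      have y: "y \<in> vecs d" by (simp add: y_def vecs_def)
      \<comment> \<open>As \<open>x\<close> is real, the component of \<open>\<psi> j y\<close>
        along \<open>u j\<close> is a real linear form in \<open>x\<close>, and it is at most the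
        norm.\<close>
      have \<psi>_ge: "s j * \<bar>\<Sum>i<d. a j i * x i\<bar> \<le> norm (\<psi> j y)" if "j < n" for j
      proof -
        have "\<psi> j y = (\<Sum>i<d. x i *\<^sub>R b j i)"
          using dualsp_expand[OF \<psi>[OF that] y] by (simp add: y_def b_def scaleR_conv_of_real)
        then have "\<psi> j y \<bullet> u j = s j * (\<Sum>i<d. a j i * x i)"
          using s_pos[OF that] by (simp add: inner_sum_left sum_distrib_left a_def mult.commute)
        moreover have "\<bar>\<psi> j y \<bullet> u j\<bar> \<le> norm (\<psi> j y)" using u(1) by (rule Basis_le_norm)
        ultimately show ?thesis using s_pos[OF that] by (simp add: abs_mult)
      qed
      have "(\<Prod>j<n. s j) * (1 / 225) ^ n \<le> (\<Prod>j<n. s j) * (\<Prod>j<n. \<bar>\<Sum>i<d. a j i * x i\<bar>)"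
        using x s_pos by (intro mult_left_mono prod_nonneg) (auto intro: less_imp_le)
      also have "\<dots> \<le> (\<Prod>j<n. norm (\<psi> j y))"
        unfolding prod.distrib[symmetric] using \<psi>_ge s_pos
        by (intro prod_mono) (auto intro!: mult_nonneg_nonneg intro: less_imp_le)
      finally have \<Psi>_ge: "(\<Prod>j<n. s j) * (1 / 225) ^ n \<le> norm (\<Psi> y)"
        unfolding \<Psi>_def prod_norm .
      \<comment> \<open>\<open>\<Psi>\<close> is homogeneous of degree \<open>n\<close>. The point
        \<open>y = 0\<close> cannot be normalized: for \<open>n = 0\<close> the product is
        constantly 1, and for \<open>n > 0\<close> the lower bound on \<open>\<Psi> y\<close>
        excludes it.\<close>
      have le_fnorm: "norm (\<Psi> y) \<le> R ^ n * fnorm N d \<Psi>"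
      proof (cases "y = (\<lambda>i. 0)")
        case y0: True
        show ?thesis
        proof (cases "n = 0")
          case True
          obtain z where "z \<in> sphere" using sphere_nonempty by blast
          from fnorm_upper[OF bdd this] show ?thesis using True by (simp add: \<Psi>_def)
        next
          case False
          have "0 < (\<Prod>j<n. s j) * (1 / 225) ^ n"
            using s_pos by (intro mult_pos_pos prod_pos) auto
          with \<Psi>_ge have "\<Psi> y \<noteq> 0" by auto
          then have "\<psi> 0 y \<noteq> 0" using False by (auto simp: \<Psi>_def)
          moreover have "\<psi> 0 y = 0"
            using dualsp_expand[OF \<psi> y, of 0] y0 False by simp
          ultimately show ?thesis by simp
        qed
      next
        case False
        let ?z = "\<lambda>i. of_real (1 / N y) * y i"
        have Ny: "0 < N y" "N y \<le> R" using norm_pos[OF y False] Nx by (auto simp: y_def)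
        have "\<Psi> ?z = (\<Prod>j<n. of_real (1 / N y) * \<psi> j y)"
          unfolding \<Psi>_def by (intro prod.cong refl dualsp_scale[where d = d] \<psi> y) simp
        also have "\<dots> = of_real (1 / N y) ^ n * \<Psi> y"
          unfolding \<Psi>_def prod.distrib by simp
        finally have "norm (\<Psi> ?z) = (1 / N y) ^ n * norm (\<Psi> y)"
          using Ny by (simp add: norm_mult norm_power norm_divide)
        then have "norm (\<Psi> y) = N y ^ n * norm (\<Psi> ?z)"
          using Ny by (simp add: power_divide)
        also have "\<dots> \<le> R ^ n * fnorm N d \<Psi>"
        proof (rule mult_mono)
          show "N y ^ n \<le> R ^ n" using Ny by (intro power_mono) auto
          show "norm (\<Psi> ?z) \<le> fnorm N d \<Psi>"
            by (rule fnorm_upper[OF bdd normalize_in_sphere[OF y False]])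
        qed (use \<open>0 < R\<close> in auto)
        finally show ?thesis .
      qed
      have "(\<Prod>j<n. fnorm N d (\<psi> j)) \<le> (\<Prod>j<n. (S * ?D) * s j)"
      proof (intro prod_mono conjI fnorm0)
        fix j assume "j \<in> {..<n}"
        then have "fnorm N d (\<psi> j) \<le> S * l j" by (intro fnorm_le) simp
        also have "\<dots> \<le> S * (?D * s j)" using S_pos by (intro mult_left_mono ls) simp
        finally show "fnorm N d (\<psi> j) \<le> (S * ?D) * s j" by (simp only: mult.assoc)
      qed auto
      also have "\<dots> = (225 * ?D * S) ^ n * ((\<Prod>j<n. s j) * (1 / 225) ^ n)"
        by (simp add: prod.distrib power_mult_distrib power_divide)
      also have "\<dots> \<le> (225 * ?D * S) ^ n * (R ^ n * fnorm N d \<Psi>)"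
        using \<Psi>_ge le_fnorm S_pos by (intro mult_left_mono) auto
      finally show ?thesis by (simp add: power_mult_distrib mult.assoc)
    qed
    then show "(\<Prod>j<n. fnorm N d (\<psi> j)) \<le> (225 * ?D * S * R) ^ n * fnorm N d (\<lambda>x. \<Prod>j<n. \<psi> j x)"
      by (simp add: \<Psi>_def[abs_def])
  qed
qed

text \<open>Testing a sign functional on its own sign vector gives norm at least
  \<open>d / \<nu>\<close>, while the mean square over all signs is the squared Euclidean norm, at
  most \<open>S\<^sup>2\<close> on the sphere.\<close>

lemma sign_functionals_le_cconst:
  fixes N :: "(nat \<Rightarrow> 'k::{real_normed_field,real_inner}) \<Rightarrow> real"
  assumes "polynomially_bounded_norm N d S M" and "0 < \<nu>"
    and signs: "\<And>A. N (\<lambda>i. if i < d then (if i \<in> A then 1 else - 1) else 0) \<le> \<nu>"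
  shows "real d / \<nu> / S \<le> cconst N d"
proof -
  interpret polynomially_bounded_norm N d S M by fact
  define \<epsilon> :: "nat set \<Rightarrow> nat \<Rightarrow> 'k" where "\<epsilon> A i = (if i \<in> A then 1 else - 1)" for A i
  show ?thesis
  proof (rule quotient_le_cconst)
    show "finite (Pow {..<d})" "Pow {..<d} \<noteq> {}" by auto
    show "0 \<le> real d / \<nu>" "0 < S" "0 < (2::real)" using \<open>0 < \<nu>\<close> S_pos by auto
    fix A
    show dual: "(\<lambda>x. \<Sum>i<d. x i * \<epsilon> A i) \<in> dualsp d" by (rule linear_form_in_dualsp)
    let ?x = "\<lambda>i. if i < d then \<epsilon> A i else 0"
    have x: "?x \<in> vecs d" "?x \<noteq> (\<lambda>i. 0)"
      using dim_pos by (auto simp: vecs_def fun_eq_iff \<epsilon>_def intro!: exI[of _ 0])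
    have "(\<Sum>i<d. ?x i * \<epsilon> A i) = of_nat d" by (simp add: \<epsilon>_def if_distrib cong: if_cong)
    then have "real d / N ?x \<le> fnorm N d (\<lambda>x. \<Sum>i<d. x i * \<epsilon> A i)"
      using fnorm_ge_quotient[OF dual x] by simp
    moreover have "N ?x \<le> \<nu>" unfolding \<epsilon>_def by (rule signs)
    then have "real d / \<nu> \<le> real d / N ?x"
      using norm_pos[OF x] \<open>0 < \<nu>\<close> by (intro divide_left_mono mult_pos_pos) auto
    ultimately show "real d / \<nu> \<le> fnorm N d (\<lambda>x. \<Sum>i<d. x i * \<epsilon> A i)" by linarith
  next
    fix x assume "x \<in> sphere"
    then have "sqrt (\<Sum>i<d. (norm (x i))\<^sup>2) \<le> S" using sphere_le by (simp add: sphere_def)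
    then have "(\<Sum>i<d. (norm (x i))\<^sup>2) \<le> S\<^sup>2" using S_pos by (simp add: sqrt_le_D)
    moreover have "(\<Sum>i<d. x i * \<epsilon> A i) = (\<Sum>i<d. if i \<in> A then x i else - x i)" for A
      by (intro sum.cong) (auto simp: \<epsilon>_def)
    ultimately show "(\<Sum>A\<in>Pow {..<d}. norm (\<Sum>i<d. x i * \<epsilon> A i) powr 2) \<le> real (card (Pow {..<d})) * S powr 2"
      using sum_norm_signed_sum_squared[of "{..<d}" x] S_pos by (simp add: card_Pow)
  qed
qed

section \<open>The norms with finite exponent \<open>p\<close>\<close>

lemma lpnorm_scale:
  "0 < p \<Longrightarrow> lpnorm p d (\<lambda>i. c * x i) = norm c * lpnorm p d x"
  by (simp add: lpnorm_def norm_mult powr_mult sum_distrib_left[symmetric] sum_nonneg powr_powr)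

lemma lpnorm_pos:
  assumes "0 < p" "x \<in> vecs d" "x \<noteq> (\<lambda>i. 0)"
  shows "0 < lpnorm p d x"
proof -
  obtain i where "x i \<noteq> 0" using assms by auto
  then have "i < d" using assms by (metis (mono_tags, lifting) mem_Collect_eq not_le vecs_def)
  have "0 < norm (x i) powr p" using \<open>x i \<noteq> 0\<close> by simp
  also have "\<dots> \<le> (\<Sum>i<d. norm (x i) powr p)" using \<open>i < d\<close> by (intro member_le_sum) auto
  finally show ?thesis by (simp add: lpnorm_def)
qed

lemma lpnorm_eq_1_iff:
  assumes "0 < p"
  shows "lpnorm p d x = 1 \<longleftrightarrow> (\<Sum>i<d. norm (x i) powr p) = 1"
proof
  assume "lpnorm p d x = 1"
  then have "((\<Sum>i<d. norm (x i) powr p) powr (1 / p)) powr p = 1" by (simp add: lpnorm_def)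
  then show "(\<Sum>i<d. norm (x i) powr p) = 1" using assms by (simp add: powr_powr sum_nonneg)
qed (simp add: lpnorm_def)

text \<open>On the unit sphere all coordinates are at most 1 in modulus, so squares lie below
  \<open>p\<close>-th powers.\<close>

lemma coordinate_norm_lp_le_2:
  assumes "0 < d" "0 < p" "p \<le> 2"
  shows "coordinate_norm (lpnorm p d :: (nat \<Rightarrow> 'k::real_normed_field) \<Rightarrow> real) d 1"
proof
  fix x :: "nat \<Rightarrow> 'k" assume "lpnorm p d x = 1"
  then have eq: "(\<Sum>i<d. norm (x i) powr p) = 1" using assms by (simp add: lpnorm_eq_1_iff)
  have "(\<Sum>i<d. (norm (x i))\<^sup>2) \<le> (\<Sum>i<d. norm (x i) powr p)"
  proof (intro sum_mono)
    fix i assume "i \<in> {..<d}"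
    then have "norm (x i) powr p \<le> 1" unfolding eq[symmetric] by (intro member_le_sum) auto
    then have "norm (x i) \<le> 1" using powr_mono2[of "1 / p" "norm (x i) powr p" 1] assms by (simp add: powr_powr)
    then have "norm (x i) powr 2 \<le> norm (x i) powr p" using assms by (intro powr_mono') auto
    then show "(norm (x i))\<^sup>2 \<le> norm (x i) powr p" by simp
  qed
  then show "sqrt (\<Sum>i<d. (norm (x i))\<^sup>2) \<le> 1" using eq by simp
qed (use assms in \<open>auto intro!: lpnorm_scale lpnorm_pos\<close>)

text \<open>The bound is the Euclidean norm of the constant vector with entries
  \<open>real d powr (- 1 / p)\<close>.\<close>

lemma coordinate_norm_lp_ge_2:
  assumes "0 < d" "2 \<le> p"
  shows "coordinate_norm (lpnorm p d :: (nat \<Rightarrow> 'k::real_normed_field) \<Rightarrow> real) d (real d powr (1 / 2 - 1 / p))"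
proof
  fix x :: "nat \<Rightarrow> 'k" assume "lpnorm p d x = 1"
  then have eq: "(\<Sum>i<d. norm (x i) powr p) = 1" using assms by (simp add: lpnorm_eq_1_iff)
  let ?c = "(1 / real d) powr (1 - 2 / p)"
  \<comment> \<open>Weighted AM-GM with exponents \<open>2/p\<close> and \<open>1 - 2/p\<close>, applied to \<open>\<bar>x\<^sub>i\<bar>\<^sup>p\<close> and \<open>1/d\<close>.\<close>
  have "(norm (x i))\<^sup>2 * ?c \<le> 2 / p * norm (x i) powr p + (1 - 2 / p) * (1 / real d)" for i
  proof (cases "x i = 0")
    case True
    then show ?thesis using assms by simp
  next
    case False
    then show ?thesis
      using Youngs_inequality_0[of "2 / p" "1 - 2 / p" "norm (x i) powr p" "1 / real d"] assms
      by (simp add: powr_powr)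
  qed
  then have "(\<Sum>i<d. (norm (x i))\<^sup>2 * ?c) \<le> (\<Sum>i<d. 2 / p * norm (x i) powr p + (1 - 2 / p) * (1 / real d))"
    by (intro sum_mono)
  also have "\<dots> = 1" using eq assms by (simp add: sum.distrib sum_distrib_left[symmetric] sum_divide_distrib[symmetric])
  finally have "(\<Sum>i<d. (norm (x i))\<^sup>2) * ?c \<le> 1" by (simp add: sum_distrib_right)
  then have "(\<Sum>i<d. (norm (x i))\<^sup>2) \<le> 1 / ?c" using assms by (simp add: field_simps)
  also have "1 / ?c = (real d powr (1 / 2 - 1 / p))\<^sup>2"
    using assms by (simp add: powr_divide powr_powr powr_numeral[symmetric] algebra_simps del: powr_numeral)
  finally show "sqrt (\<Sum>i<d. (norm (x i))\<^sup>2) \<le> real d powr (1 / 2 - 1 / p)"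
    by (simp add: real_le_lsqrt sum_nonneg)
qed (use assms in \<open>auto intro!: lpnorm_scale lpnorm_pos\<close>)

text \<open>Since \<open>p \<le> 2 * k\<close>, the \<open>p\<close>-th power is at most 1 plus the
  \<open>2 * k\<close>-th. As \<open>k\<close> depends on \<open>p\<close> alone, so does the
  constant in front of \<open>real d powr (1 / p)\<close>.\<close>

lemma exists_common_large_point_lp:
  assumes "0 < d" "1 \<le> p"
    and "\<And>j. j < n \<Longrightarrow> (\<Sum>i<d. (a j i)\<^sup>2) = 1"
  shows "\<exists>x. (1 / 225) ^ n \<le> (\<Prod>j<n. \<bar>\<Sum>i<d. a j i * x i\<bar>) \<and>
    lpnorm p d (\<lambda>i. if i < d then of_real (x i) else (0::'k::real_normed_field)) \<le>
      (1 + 3 * (2 * real (nat \<lceil>p\<rceil>)) ^ nat \<lceil>p\<rceil>) powr (1 / p) * real d powr (1 / p)"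
proof -
  define k where "k = nat \<lceil>p\<rceil>"
  have k: "0 < k" "p \<le> real k" using assms unfolding k_def by linarith+
  obtain x where x: "(1 / 225) ^ n \<le> (\<Prod>j<n. \<bar>\<Sum>i<d. a j i * x i\<bar>)"
    and xk: "(\<Sum>i<d. x i ^ (2 * k)) \<le> 3 * real d * real ((2 * k) ^ k)"
    using exists_common_large_point[OF assms(1) k(1), of n a] assms(3) by blast
  have "\<bar>x i\<bar> powr p \<le> 1 + x i ^ (2 * k)" for i
  proof (cases "\<bar>x i\<bar> \<le> 1")
    case True
    then have "\<bar>x i\<bar> powr p \<le> 1" using assms powr_mono2[of p "\<bar>x i\<bar>" 1] by simp
    moreover have "0 \<le> x i ^ (2 * k)" by (simp add: zero_le_even_power)
    ultimately show ?thesis by linarith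
  next
    case False
    then have "\<bar>x i\<bar> powr p \<le> \<bar>x i\<bar> powr real (2 * k)" using k by (intro powr_mono) auto
    also have "\<dots> = x i ^ (2 * k)" using False by (simp add: powr_realpow power_even_abs del: of_nat_mult)
    finally show ?thesis by simp
  qed
  then have "(\<Sum>i<d. \<bar>x i\<bar> powr p) \<le> (\<Sum>i<d. 1 + x i ^ (2 * k))" by (intro sum_mono)
  also have "\<dots> \<le> (1 + 3 * (2 * real k) ^ k) * real d"
    using xk by (simp add: sum.distrib algebra_simps)
  finally have "(\<Sum>i<d. \<bar>x i\<bar> powr p) powr (1 / p) \<le> ((1 + 3 * (2 * real k) ^ k) * real d) powr (1 / p)"
    using assms by (intro powr_mono2) (auto simp: sum_nonneg)
  then show ?thesis
    using x unfolding k_def[symmetric] by (auto simp: lpnorm_def powr_mult intro!: exI[of _ x])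
qed

text \<open>\<open>K\<close> is chosen before \<open>d\<close> and \<open>S\<close>, which makes the
  upper bounds uniform in the dimension.\<close>

lemma polynomially_bounded_norm_lp:
  assumes "1 \<le> p"
  obtains K where "0 < K"
    "\<And>d S. coordinate_norm (lpnorm p d :: (nat \<Rightarrow> 'k::{real_normed_field,euclidean_space}) \<Rightarrow> real) d S \<Longrightarrow>
      polynomially_bounded_norm (lpnorm p d :: (nat \<Rightarrow> 'k) \<Rightarrow> real) d S (K * S * real d powr (1 / p))"
proof
  let ?R = "(1 + 3 * (2 * real (nat \<lceil>p\<rceil>)) ^ nat \<lceil>p\<rceil>) powr (1 / p)"
  have R: "0 < ?R" by (simp add: add_pos_nonneg less_imp_neq[THEN not_sym])
  then show "0 < 225 * sqrt DIM('k) * ?R" by simp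
  fix d S
  assume norm: "coordinate_norm (lpnorm p d :: (nat \<Rightarrow> 'k) \<Rightarrow> real) d S"
  then have d: "0 < d" by (rule coordinate_norm.dim_pos)
  have "polynomially_bounded_norm (lpnorm p d :: (nat \<Rightarrow> 'k) \<Rightarrow> real) d S
      (225 * sqrt DIM('k) * S * (?R * real d powr (1 / p)))"
    using R d by (intro polynomially_bounded_normI norm exists_common_large_point_lp assms) auto
  then show "polynomially_bounded_norm (lpnorm p d :: (nat \<Rightarrow> 'k) \<Rightarrow> real) d S
      (225 * sqrt DIM('k) * ?R * S * real d powr (1 / p))"
    by (simp add: mult_ac)
qed

text \<open>Sign vectors have norm \<open>real d powr (1 / p)\<close>. Its product with
  \<open>?S\<close> is \<open>sqrt d\<close>, so both bounds have the same order.\<close>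

lemma c_lp_asymp_sqrt:
  assumes "2 \<le> p"
  shows "asymp_from 1 (c_lp TYPE('k::{real_normed_field,euclidean_space}) p) (\<lambda>d. sqrt (real d))"
proof -
  obtain K where "0 < K" and K: "\<And>d S. coordinate_norm (lpnorm p d :: (nat \<Rightarrow> 'k) \<Rightarrow> real) d S \<Longrightarrow>
      polynomially_bounded_norm (lpnorm p d :: (nat \<Rightarrow> 'k) \<Rightarrow> real) d S (K * S * real d powr (1 / p))"
    using polynomially_bounded_norm_lp[of p, where 'k = 'k] assms by auto
  have bounds: "sqrt (real d) \<le> c_lp TYPE('k) p d \<and> c_lp TYPE('k) p d \<le> K * sqrt (real d)" if "1 \<le> d" for d
  proof -
    let ?S = "real d powr (1 / 2 - 1 / p)"
    have d: "0 < d" using that by simp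
    have S: "?S * real d powr (1 / p) = sqrt (real d)"
      using d by (simp add: powr_add[symmetric] powr_half_sqrt)
    have norm: "polynomially_bounded_norm (lpnorm p d :: (nat \<Rightarrow> 'k) \<Rightarrow> real) d ?S (K * ?S * real d powr (1 / p))"
      using d assms by (intro K coordinate_norm_lp_ge_2)
    have "real d / real d powr (1 / p) / ?S \<le> cconst (lpnorm p d :: (nat \<Rightarrow> 'k) \<Rightarrow> real) d"
    proof (rule sign_functionals_le_cconst[OF norm])
      fix A :: "nat set"
      have "(\<Sum>i<d. norm (if i < d then if i \<in> A then 1 else - 1 else 0 :: 'k) powr p) = (\<Sum>i<d. 1)"
        by (intro sum.cong) auto
      then show "lpnorm p d (\<lambda>i. if i < d then if i \<in> A then 1 else - 1 else 0 :: 'k) \<le> real d powr (1 / p)"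
        by (simp add: lpnorm_def)
    qed (use d in simp)
    also have "real d / real d powr (1 / p) / ?S = real d / (?S * real d powr (1 / p))"
      by (simp add: mult.commute)
    also have "\<dots> = sqrt (real d)" unfolding S by (simp add: real_div_sqrt)
    finally have "sqrt (real d) \<le> cconst (lpnorm p d :: (nat \<Rightarrow> 'k) \<Rightarrow> real) d" .
    then show ?thesis
      using polynomially_bounded_norm.cconst_le[OF norm] S by (simp add: c_lp_def mult.assoc)
  qed
  show ?thesis
    unfolding asymp_from_def prec_from_def
    by (intro conjI exI[of _ K] exI[of _ 1]) (use bounds \<open>0 < K\<close> in auto)
qed

text \<open>The lower bound uses the \<open>d\<close> coordinate functionals: their norms are at
  least 1, and on the unit sphere the mean of \<open>norm (x i) powr p\<close> is
  \<open>1 / d\<close>.\<close>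

lemma c_lp_asymp_root:
  assumes "1 \<le> p" "p \<le> 2"
  shows "asymp_from 1 (c_lp TYPE('k::{real_normed_field,euclidean_space}) p) (\<lambda>d. real d powr (1 / p))"
proof -
  obtain K where "0 < K" and K: "\<And>d S. coordinate_norm (lpnorm p d :: (nat \<Rightarrow> 'k) \<Rightarrow> real) d S \<Longrightarrow>
      polynomially_bounded_norm (lpnorm p d :: (nat \<Rightarrow> 'k) \<Rightarrow> real) d S (K * S * real d powr (1 / p))"
    using polynomially_bounded_norm_lp[of p, where 'k = 'k] assms by auto
  have bounds: "real d powr (1 / p) \<le> c_lp TYPE('k) p d \<and> c_lp TYPE('k) p d \<le> K * real d powr (1 / p)"
    if "1 \<le> d" for d
  proof -
    have d: "0 < d" using that by simp
    have norm: "polynomially_bounded_norm (lpnorm p d :: (nat \<Rightarrow> 'k) \<Rightarrow> real) d 1 (K * 1 * real d powr (1 / p))"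
      using d assms by (intro K coordinate_norm_lp_le_2) auto
    interpret polynomially_bounded_norm "lpnorm p d :: (nat \<Rightarrow> 'k) \<Rightarrow> real" d 1 "K * 1 * real d powr (1 / p)"
      by (rule norm)
    have "1 / real d powr (- (1 / p)) \<le> cconst (lpnorm p d :: (nat \<Rightarrow> 'k) \<Rightarrow> real) d"
    proof (rule quotient_le_cconst)
      show "finite {..<d}" "{..<d} \<noteq> {}" "0 \<le> (1::real)" "0 < real d powr (- (1 / p))" "0 < p"
        using d assms by auto
      fix i assume "i \<in> {..<d}"
      then have i: "i < d" by simp
      show dual: "(\<lambda>x. x i) \<in> dualsp d" by (simp add: dualsp_def)
      have e: "basis_vec i \<in> vecs d" "basis_vec i \<noteq> (\<lambda>i. 0 :: 'k)"
        using i by (auto simp: vecs_def fun_eq_iff)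
      have "(\<Sum>j<d. norm (basis_vec i j :: 'k) powr p) = (\<Sum>j<d. if j = i then 1 else 0)"
        by (intro sum.cong) auto
      then have "lpnorm p d (basis_vec i :: nat \<Rightarrow> 'k) = 1" using i by (simp add: lpnorm_def)
      then show "1 \<le> fnorm (lpnorm p d) d (\<lambda>x. x i :: 'k)" using fnorm_ge_quotient[OF dual e] by simp
    next
      fix x assume "x \<in> sphere"
      then have "(\<Sum>i<d. norm (x i) powr p) = 1" using assms by (simp add: sphere_def lpnorm_eq_1_iff)
      then show "(\<Sum>i<d. norm (x i) powr p) \<le> real (card {..<d}) * (real d powr (- (1 / p))) powr p"
        using d assms by (simp add: powr_powr powr_neg_one)
    qed
    then show ?thesis using cconst_le by (simp add: c_lp_def powr_minus_divide)
  qed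
  show ?thesis
    unfolding asymp_from_def prec_from_def
    by (intro conjI exI[of _ K] exI[of _ 1]) (use bounds \<open>0 < K\<close> in auto)
qed

section \<open>The maximum norm\<close>

lemma linfnorm_le_iff: "0 < d \<Longrightarrow> linfnorm d x \<le> B \<longleftrightarrow> (\<forall>i<d. norm (x i) \<le> B)"
  unfolding linfnorm_def by (subst Max_le_iff) auto

lemma norm_le_linfnorm: "i < d \<Longrightarrow> norm (x i) \<le> linfnorm d x"
  unfolding linfnorm_def by (intro Max_ge) auto

lemma coordinate_norm_linf:
  assumes "0 < d"
  shows "coordinate_norm (linfnorm d :: (nat \<Rightarrow> 'k::real_normed_field) \<Rightarrow> real) d (sqrt (real d))"
proof
  fix x :: "nat \<Rightarrow> 'k" and c
  have "linfnorm d (\<lambda>i. c * x i) = Max ((\<lambda>t. norm c * t) ` (\<lambda>i. norm (x i)) ` {..<d})"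
    by (simp add: linfnorm_def image_image norm_mult)
  also have "\<dots> = norm c * linfnorm d x"
    unfolding linfnorm_def using assms
    by (intro mono_Max_commute[symmetric] monoI mult_left_mono) auto
  finally show "linfnorm d (\<lambda>i. c * x i) = norm c * linfnorm d x" .
next
  fix x :: "nat \<Rightarrow> 'k" assume "x \<in> vecs d" "x \<noteq> (\<lambda>i. 0)"
  moreover from this obtain i where "x i \<noteq> 0" by auto
  ultimately have "i < d" by (auto simp: vecs_def not_le[symmetric])
  then show "0 < linfnorm d x" using \<open>x i \<noteq> 0\<close> norm_le_linfnorm[of i d x] by (meson less_le_trans zero_less_norm_iff)
next
  fix x :: "nat \<Rightarrow> 'k" assume "linfnorm d x = 1"
  then have "(\<Sum>i<d. (norm (x i))\<^sup>2) \<le> (\<Sum>i<d. 1)"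
    using norm_le_linfnorm[of _ d x] by (intro sum_mono) (auto intro!: power_le_one)
  then show "sqrt (\<Sum>i<d. (norm (x i))\<^sup>2) \<le> sqrt (real d)" by simp
qed (use assms in auto)

text \<open>One coordinate is bounded by the whole moment sum. With \<open>k\<close> about
  \<open>ln (3 * d)\<close> the factor \<open>3 * d\<close> is at most \<open>3 ^ k\<close>, so
  \<open>k\<close>-th roots leave a bound of order \<open>k\<close> for
  \<open>(x i)\<^sup>2\<close>.\<close>

lemma exists_common_large_point_linf:
  assumes "2 \<le> d" and "\<And>j. j < n \<Longrightarrow> (\<Sum>i<d. (a j i)\<^sup>2) = 1"
  shows "\<exists>x. (1 / 225) ^ n \<le> (\<Prod>j<n. \<bar>\<Sum>i<d. a j i * x i\<bar>) \<and>
    linfnorm d (\<lambda>i. if i < d then of_real (x i) else (0::'k::real_normed_field)) \<le> sqrt (42 * ln (real d))"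
proof -
  define k where "k = nat \<lceil>ln (3 * real d)\<rceil>"
  have "0 < ln (3 * real d)" using assms by (intro ln_gt_zero) auto
  then have k: "0 < k" "ln (3 * real d) \<le> real k" "real k \<le> ln (3 * real d) + 1"
    unfolding k_def by linarith+
  have d: "0 < d" using assms by simp
  obtain x where x: "(1 / 225) ^ n \<le> (\<Prod>j<n. \<bar>\<Sum>i<d. a j i * x i\<bar>)"
    and xk: "(\<Sum>i<d. x i ^ (2 * k)) \<le> 3 * real d * real ((2 * k) ^ k)"
    using exists_common_large_point[OF d k(1), of n a] assms(2) by blast
  have "exp (ln (3 * real d)) \<le> exp (real k)" using k(2) by simp
  also have "\<dots> = exp 1 ^ k" by (simp add: exp_of_nat_mult[symmetric])
  also have "\<dots> \<le> 3 ^ k" using exp_le by (intro power_mono) auto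
  finally have 3: "3 * real d \<le> 3 ^ k" using d by simp
  have "ln (1/2) \<le> 1/2 - (1::real)" by (rule ln_le_minus_one) simp
  then have ln2: "1 / 2 \<le> ln (2::real)" by (simp add: ln_div)
  also have "\<dots> \<le> ln (real d)" using assms by simp
  finally have lnd: "1 / 2 \<le> ln (real d)" .
  \<comment> \<open>\<open>k \<le> ln d + ln 3 + 1 \<le> ln d + 3\<close>, and
    \<open>3 \<le> 6 * ln d\<close> because \<open>ln d\<close> is at least \<open>1 / 2\<close>;
    hence 7, and \<open>42 = 6 * 7\<close> below.\<close>
  have "ln (3::real) \<le> 3 - 1" by (rule ln_le_minus_one) simp
  then have k7: "real k \<le> 7 * ln (real d)" using k(3) lnd d by (simp add: ln_mult)
  have "\<bar>x i\<bar> \<le> sqrt (42 * ln (real d))" if "i < d" for i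
  proof -
    have "((x i)\<^sup>2) ^ k = x i ^ (2 * k)" by (simp add: power_mult)
    also have "\<dots> \<le> (\<Sum>i<d. x i ^ (2 * k))"
      using that by (intro member_le_sum) (auto simp: zero_le_even_power)
    also note xk
    also have "3 * real d * real ((2 * k) ^ k) = 3 * real d * (2 * real k) ^ k" by simp
    also have "\<dots> \<le> 3 ^ k * (2 * real k) ^ k" by (intro mult_right_mono 3) simp
    also have "\<dots> = (6 * real k) ^ k" by (subst power_mult_distrib[symmetric]) simp
    finally have "(x i)\<^sup>2 \<le> 6 * real k" using k(1) by (subst (asm) power_mono_iff) auto
    also have "\<dots> \<le> 42 * ln (real d)" using k7 by simp
    finally show ?thesis by (simp add: real_le_rsqrt)
  qed
  then show ?thesis using x d by (auto simp: linfnorm_le_iff intro!: exI[of _ x])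
qed

lemma polynomially_bounded_norm_linf:
  assumes "2 \<le> d"
  shows "polynomially_bounded_norm (linfnorm d :: (nat \<Rightarrow> 'k::{real_normed_field,euclidean_space}) \<Rightarrow> real) d
    (sqrt (real d)) (225 * sqrt DIM('k) * sqrt (real d) * sqrt (42 * ln (real d)))"
  using assms by (intro polynomially_bounded_normI coordinate_norm_linf exists_common_large_point_linf) auto

text \<open>Sign vectors have maximum norm 1 and \<open>S\<close> is \<open>sqrt d\<close>, so sign
  functionals give \<open>d / sqrt d\<close>.\<close>

lemma sqrt_prec_c_linf:
  "prec_from 2 (\<lambda>d. sqrt (real d)) (c_linf TYPE('k::{real_normed_field,euclidean_space}))"
  unfolding prec_from_def
proof (intro exI[of _ 1] conjI allI impI)
  fix d :: nat assume d: "2 \<le> d"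
  have "real d / 1 / sqrt (real d) \<le> cconst (linfnorm d :: (nat \<Rightarrow> 'k) \<Rightarrow> real) d"
    using d by (intro sign_functionals_le_cconst[OF polynomially_bounded_norm_linf]) (auto simp: linfnorm_le_iff)
  then show "sqrt (real d) \<le> 1 * c_linf TYPE('k) d" by (simp add: c_linf_def real_div_sqrt)
qed simp

text \<open>At \<open>d = 1\<close> the right-hand side is 0, hence the start at 2.\<close>

lemma c_linf_prec_sqrt_ln:
  "prec_from 2 (c_linf TYPE('k::{real_normed_field,euclidean_space})) (\<lambda>d. sqrt (real d * ln (real d)))"
  unfolding prec_from_def
proof (intro exI[of _ "225 * sqrt DIM('k) * sqrt 42"] conjI allI impI)
  fix d :: nat assume "2 \<le> d"
  from polynomially_bounded_norm.cconst_le[OF polynomially_bounded_norm_linf[OF this, where 'k = 'k]]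
  show "c_linf TYPE('k) d \<le> 225 * sqrt DIM('k) * sqrt 42 * sqrt (real d * ln (real d))"
    by (simp add: c_linf_def real_sqrt_mult mult_ac)
qed simp

theorem theorem2p1:
  shows "(\<forall>p::real. 2 \<le> p \<longrightarrow> asymp_from 1 (c_lp TYPE(real) p) (\<lambda>d. sqrt (real d))) \<and>
     (\<forall>p::real. 1 \<le> p \<and> p \<le> 2 \<longrightarrow> asymp_from 1 (c_lp TYPE(real) p) (\<lambda>d. real d powr (1 / p))) \<and>
     prec_from 2 (\<lambda>d. sqrt (real d)) (c_linf TYPE(real)) \<and>
     prec_from 2 (c_linf TYPE(real)) (\<lambda>d. sqrt (real d * ln (real d))) \<and>
     (\<forall>p::real. 2 \<le> p \<longrightarrow> asymp_from 1 (c_lp TYPE(complex) p) (\<lambda>d. sqrt (real d))) \<and>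
     (\<forall>p::real. 1 \<le> p \<and> p \<le> 2 \<longrightarrow> asymp_from 1 (c_lp TYPE(complex) p) (\<lambda>d. real d powr (1 / p))) \<and>
     prec_from 2 (\<lambda>d. sqrt (real d)) (c_linf TYPE(complex)) \<and>
     prec_from 2 (c_linf TYPE(complex)) (\<lambda>d. sqrt (real d * ln (real d)))"
  by (intro conjI allI impI c_lp_asymp_sqrt c_lp_asymp_root sqrt_prec_c_linf c_linf_prec_sqrt_ln) auto

end
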